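(* Fix $t\in[0,T)$. For every $x\in[0,1]$ the set $$\operatorname*{argmax}_{y\in[0,1]}\left(\frac{v(t,y)}{1-\gamma}\left(\Big(\frac{1+\overline{\epsilon}x}{1+\overline{\epsilon}y}\Big)^{1-\gamma}1_{\{x\le y\}}+\Big(\frac{1-\underline{\epsilon}x}{1-\underline{\epsilon}y}\Big)^{1-\gamma}1_{\{x>y\}}\right)\right)$$ is a singleton, and its unique element $\hat y(t,x)$ is $$\hat y(t,x)=\begin{cases}\underline{y}(t)&\text{if }x\in[0,\underline{y}(t)),\\ x&\text{if }x\in[\underline{y}(t),\overline{y}(t)],\\ \overline{y}(t)&\text{if }x\in(\overline{y}(t),1].\end{cases}$$
   Context: Fix constants $\mu\in\mathbb{R}$, $\sigma>0$, $T>0$, $\lambda>0$, $\gamma\in(0,\infty)\setminus\{1\}$, $\overline{\epsilon}\in(0,\infty)$, $\underline{\epsilon}\in(0,1)$. Let $y_M:=\frac{\mu}{\gamma\sigma^2}$ and $Q(x):=-\frac{\gamma(1-\gamma)\sigma^2}{2}(x-y_M)^2+\frac{\gamma(1-\gamma)\sigma^2y_M^2}{2}$. $v$ denotes the unique function in $C^{1,2}([0,T]\times(0,1))\cap C([0,T]\times[0,1])$ such that, with $$S(t,x):=(1-\gamma)\sup_{y\in[0,1]}\Big(\tfrac{v(t,y)}{1-\gamma}\Big[\big(\tfrac{1+\overline{\epsilon} x}{1+\overline{\epsilon} y}\big)^{1-\gamma}1_{\{x\le y\}}+\big(\tfrac{1-\underline{\epsilon} x}{1-\underline{\epsilon} y}\big)^{1-\gamma}1_{\{x>y\}}\Big]\Big),$$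 one has $v(T,x)=1$ for all $x\in[0,1]$ and: (a) for $(t,x)\in[0,T]\times(0,1)$, $0=v_t+x(1-x)(\mu-\gamma\sigma^2x)v_x+\frac{\sigma^2x^2(1-x)^2}{2}v_{xx}+(Q(x)-\lambda)v+\lambda S(t,x)$; (b) for $x\in\{0,1\}$, $t\mapsto v(t,x)$ is $C^1$ on $[0,T]$ and $0=v_t(t,x)+(Q(x)-\lambda)v(t,x)+\lambda S(t,x)$; (c) $v_t$, $x(1-x)v_x$, $x^2(1-x)^2v_{xx}$ are bounded on $[0,T]\times(0,1)$. (The function $\frac{w^{1-\gamma}}{1-\gamma}v(t,x)$ is the value function of a power-utility investor with proportional costs $\overline{\epsilon}$ on purchases and $\underline{\epsilon}$ on sales who can trade only at the jump times of a Poisson process of intensity $\lambda$; $\hat y(t,x)$ is the optimal post-trade stock fraction, used as feedback, when the pre-trade stock fraction is $x$.) For $t\in[0,T)$, $0\le\underline{y}(t)\le\overline{y}(t)\le1$ are the unique maximizers over $y\in[0,1]$ of $y\mapsto\frac{v(t,y)}{(1-\gamma)(1+\overline{\epsilon}y)^{1-\gamma}}$ and $y\mapsto\frac{v(t,y)}{(1-\gamma)(1-\underline{\epsilon}y)^{1-\gamma}}$, respectively. *)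

theory Defs
  imports "HOL-Analysis.Analysis"
begin

definition argmax_on :: "(real \<Rightarrow> real) \<Rightarrow> real set \<Rightarrow> real set" where
  "argmax_on f A = {y. is_arg_max f (\<lambda>y. y \<in> A) y}"

definition y_M :: "real \<Rightarrow> real \<Rightarrow> real \<Rightarrow> real" where
  "y_M \<mu> \<sigma> \<gamma> = \<mu> / (\<gamma> * \<sigma>\<^sup>2)"

definition Q :: "real \<Rightarrow> real \<Rightarrow> real \<Rightarrow> real \<Rightarrow> real" where
  "Q \<mu> \<sigma> \<gamma> x =
     - (\<gamma> * (1 - \<gamma>) * \<sigma>\<^sup>2 / 2) * (x - y_M \<mu> \<sigma> \<gamma>)\<^sup>2
     + \<gamma> * (1 - \<gamma>) * \<sigma>\<^sup>2 * (y_M \<mu> \<sigma> \<gamma>)\<^sup>2 / 2"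

text \<open>
  Throughout, \<open>eb\<close> is the proportional cost on purchases (\<open>\<epsilon>\<close> with overline) and
  \<open>es\<close> the one on sales (\<open>\<epsilon>\<close> with underline).  In \<open>trade_objective\<close>, \<open>x\<close> and \<open>y\<close> are
  the stock fractions before and after the trade.
\<close>

definition trade_objective ::
  "real \<Rightarrow> real \<Rightarrow> real \<Rightarrow> (real \<Rightarrow> real \<Rightarrow> real) \<Rightarrow> real \<Rightarrow> real \<Rightarrow> real \<Rightarrow> real" where
  "trade_objective \<gamma> eb es v t x y =
     v t y / (1 - \<gamma>) *
       (if x \<le> y then ((1 + eb * x) / (1 + eb * y)) powr (1 - \<gamma>)
        else ((1 - es * x) / (1 - es * y)) powr (1 - \<gamma>))"

text \<open>
  If \<open>v\<close> is continuous on \<open>{0..T} \<times> {0..1}\<close>, \<open>eb > 0\<close> and \<open>0 < es < 1\<close>, then the objective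
  is bounded in \<open>y \<in> {0..1}\<close>, so the conditionally complete supremum below is the actual one.
\<close>

definition S ::
  "real \<Rightarrow> real \<Rightarrow> real \<Rightarrow> (real \<Rightarrow> real \<Rightarrow> real) \<Rightarrow> real \<Rightarrow> real \<Rightarrow> real" where
  "S \<gamma> eb es v t x = (1 - \<gamma>) * (SUP y\<in>{0..1}. trade_objective \<gamma> eb es v t x y)"

text \<open>
  \<open>v\<close> is of class \<open>C\<^sup>1\<^sup>,\<^sup>2\<close> on \<open>[0,T] \<times> (0,1)\<close> with partial derivatives \<open>vt\<close>, \<open>vx\<close>, \<open>vxx\<close>;
  the time derivative is one-sided at \<open>0\<close> and \<open>T\<close>.
\<close>

definition C12_with ::
  "real \<Rightarrow> (real \<Rightarrow> real \<Rightarrow> real) \<Rightarrow> (real \<Rightarrow> real \<Rightarrow> real) \<Rightarrow> (real \<Rightarrow> real \<Rightarrow> real)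
     \<Rightarrow> (real \<Rightarrow> real \<Rightarrow> real) \<Rightarrow> bool" where
  "C12_with T v vt vx vxx \<longleftrightarrow>
     (\<forall>t\<in>{0..T}. \<forall>x\<in>{0<..<1}.
        ((\<lambda>s. v s x) has_real_derivative vt t x) (at t within {0..T}) \<and>
        ((\<lambda>z. v t z) has_real_derivative vx t x) (at x) \<and>
        ((\<lambda>z. vx t z) has_real_derivative vxx t x) (at x)) \<and>
     continuous_on ({0..T} \<times> {0<..<1}) (\<lambda>(t, x). v t x) \<and>
     continuous_on ({0..T} \<times> {0<..<1}) (\<lambda>(t, x). vt t x) \<and>
     continuous_on ({0..T} \<times> {0<..<1}) (\<lambda>(t, x). vx t x) \<and>
     continuous_on ({0..T} \<times> {0<..<1}) (\<lambda>(t, x). vxx t x)"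

text \<open>The characterisation of the reduced value function by its HJB equation on \<open>[0,T] \<times> [0,1]\<close>.\<close>

definition solves_HJB ::
  "real \<Rightarrow> real \<Rightarrow> real \<Rightarrow> real \<Rightarrow> real \<Rightarrow> real \<Rightarrow> real \<Rightarrow> (real \<Rightarrow> real \<Rightarrow> real) \<Rightarrow> bool" where
  "solves_HJB \<mu> \<sigma> T lam \<gamma> eb es v \<longleftrightarrow>
     continuous_on ({0..T} \<times> {0..1}) (\<lambda>(t, x). v t x) \<and>
     (\<forall>x\<in>{0..1}. v T x = 1) \<and>
     (\<exists>vt vx vxx.
        C12_with T v vt vx vxx \<and>
        (\<forall>t\<in>{0..T}. \<forall>x\<in>{0<..<1}.
           0 = vt t x + x * (1 - x) * (\<mu> - \<gamma> * \<sigma>\<^sup>2 * x) * vx t x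
               + \<sigma>\<^sup>2 * x\<^sup>2 * (1 - x)\<^sup>2 / 2 * vxx t x
               + (Q \<mu> \<sigma> \<gamma> x - lam) * v t x + lam * S \<gamma> eb es v t x) \<and>
        bounded ((\<lambda>(t, x). vt t x) ` ({0..T} \<times> {0<..<1})) \<and>
        bounded ((\<lambda>(t, x). x * (1 - x) * vx t x) ` ({0..T} \<times> {0<..<1})) \<and>
        bounded ((\<lambda>(t, x). x\<^sup>2 * (1 - x)\<^sup>2 * vxx t x) ` ({0..T} \<times> {0<..<1}))) \<and>
     (\<forall>x\<in>{0, 1}. \<exists>w. continuous_on {0..T} w \<and>
        (\<forall>t\<in>{0..T}.
           ((\<lambda>s. v s x) has_real_derivative w t) (at t within {0..T}) \<and>
           0 = w t + (Q \<mu> \<sigma> \<gamma> x - lam) * v t x + lam * S \<gamma> eb es v t x))"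

end

theory Submission
  imports Defs
begin

text \<open>
  The homogeneous extension \<open>U(b, s) = (b + s)\<^sup>1\<^sup>-\<^sup>\<gamma> v(t, s / (b + s)) / (1 - \<gamma>)\<close> of the value
  function to cash and stock positions is concave and nondecreasing in cash. A minimum principle
  gives both at once, applied to \<open>U(r) - \<theta> U(p) - (1 - \<theta>) U(q)\<close> on the set of
  \<open>r \<ge> \<theta> p + (1 - \<theta>) q\<close>: the diffusion part of the HJB equation acts only along the
  flow \<open>(b, s) \<mapsto> (b, s e\<^sup>z)\<close>, which preserves this constraint, and the jump part preserves it
  because the cost of a trade is convex and proportional. By homogeneity one may take
  \<open>r = (1 - x, x)\<close>, which makes the constraint set bounded.
  Restricted to the lines \<open>b + (1 + \<epsilon>) s = 1\<close>, concavity together with the uniqueness of the two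
  maximizers yields strict monotonicity on either side of them, and the optimal trade
  can be read off.
\<close>

section \<open>One-dimensional calculus: extremum conditions and a power inequality\<close>

lemma second_order_minimum:
  fixes h h' :: "real \<Rightarrow> real"
  assumes h: "\<And>z. (h has_real_derivative h' z) (at z)"
    and h': "(h' has_real_derivative h'') (at 0)"
    and min: "\<And>z. h 0 \<le> h z"
  shows "h' 0 = 0" and "0 \<le> h''"
proof -
  show zero: "h' 0 = 0"
    using DERIV_local_min[OF h zero_less_one] min by auto
  show "0 \<le> h''"
  proof (rule ccontr)
    assume "\<not> 0 \<le> h''"
    then obtain d where d: "d > 0" "\<And>z. 0 < z \<Longrightarrow> z < d \<Longrightarrow> h' z < 0"
      using DERIV_neg_dec_right[OF h'] zero by auto
    have "\<exists>z. 0 < z \<and> z < d/2 \<and> h (d/2) - h 0 = (d/2 - 0) * h' z"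
      using MVT2[of 0 "d/2" h h'] h d(1) by auto
    then obtain z where z: "0 < z" "z < d/2" "h (d/2) - h 0 = d/2 * h' z" by auto
    with d have "d/2 * h' z < 0" by (intro mult_pos_neg) auto
    with z(3) min[of "d/2"] show False by simp
  qed
qed

lemma right_minimum_derivative:
  fixes f :: "real \<Rightarrow> real"
  assumes f: "(f has_real_derivative d) (at t within {a..b})"
    and t: "a \<le> t" "t < b" and min: "\<And>s. s \<in> {a..b} \<Longrightarrow> f t \<le> f s"
  shows "0 \<le> d"
proof (rule ccontr)
  assume "\<not> 0 \<le> d"
  then obtain e where e: "e > 0" "\<And>h. 0 < h \<Longrightarrow> t + h \<in> {a..b} \<Longrightarrow> h < e \<Longrightarrow> f (t + h) < f t"
    using has_real_derivative_neg_dec_right[OF f] by auto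
  define h where "h = min (e/2) (b - t)"
  have "0 < h" "h < e" "t + h \<in> {a..b}" using t e(1) by (auto simp: h_def min_def)
  with e(2)[of h] min[of "t + h"] show False by auto
qed

text \<open>\<open>w powr a / a\<close> is concave, so its graph lies below the tangent at 1. For
  \<open>a < 0\<close> the point \<open>w = 0\<close> is excluded because
  \<open>0 powr a = 0\<close> would break the bound.\<close>

lemma powr_tangent:
  fixes w a :: real
  assumes a: "a < 1" "a \<noteq> 0" and w: "0 \<le> w" "a < 0 \<Longrightarrow> 0 < w"
  shows "w powr a / a \<le> 1 / a + (w - 1)"
proof (cases "w = 0")
  case True
  with assms have "0 < a" by (cases "a < 0") auto
  with True a show ?thesis by simp
next
  case False
  define L where "L = ln w"
  have wL: "w = exp L" "w powr a = exp (a * L)"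
    using False w by (auto simp: L_def powr_def)
  show ?thesis
  proof (cases "0 < a")
    case True
    have "exp ((1 - a) *\<^sub>R 0 + a *\<^sub>R L) \<le> (1 - a) * exp 0 + a * exp L"
      by (rule convex_onD[OF exp_convex]) (use a True in auto)
    then have "w powr a \<le> 1 + a * (w - 1)"
      unfolding wL(2) by (simp add: wL(1) algebra_simps)
    also have "\<dots> = (1 / a + (w - 1)) * a" using True by (simp add: algebra_simps)
    finally have "w powr a \<le> (1 / a + (w - 1)) * a" .
    then show ?thesis using True by (simp add: pos_divide_le_eq)
  next
    case False
    then have neg: "a < 0" using a by auto
    \<comment> \<open>The weight for which the convex combination of \<open>L\<close> and
      \<open>a * L\<close> vanishes, so that convexity of \<open>exp\<close> bounds
      \<open>exp 0 = 1\<close>.\<close>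
    define s where "s = 1 / (1 - a)"
    have s: "0 \<le> s" "s \<le> 1" "1 - s = - a * s" and s0: "s > 0"
      using neg by (auto simp: s_def field_simps)
    have "exp ((1 - s) *\<^sub>R L + s *\<^sub>R (a * L)) \<le> (1 - s) * exp L + s * exp (a * L)"
      by (rule convex_onD[OF exp_convex]) (use s in auto)
    moreover have "(1 - s) *\<^sub>R L + s *\<^sub>R (a * L) = 0" unfolding s(3) by simp
    ultimately have "1 \<le> s * (exp (a * L) - a * exp L)" 
      unfolding s(3) by (simp add: algebra_simps)
    then have "1 - a \<le> exp (a * L) - a * exp L" using neg
      by (simp add: s_def pos_le_divide_eq)
    then have "1 + a * (w - 1) \<le> w powr a"
      unfolding wL(2) by (simp add: wL(1) algebra_simps)
    moreover have "1 + a * (w - 1) = (1 / a + (w - 1)) * a" using neg by (simp add: algebra_simps)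
    ultimately have "(1 / a + (w - 1)) * a \<le> w powr a" by simp
    then show ?thesis using neg by (simp add: neg_divide_le_eq)
  qed
qed

section \<open>The flow that scales the stock position\<close>

text \<open>
  The position \<open>(1 - x, x)\<close> is carried by the flow to \<open>(1 - x, x e\<^sup>z)\<close>, of total wealth
  \<open>flow_mass x z\<close> and stock fraction \<open>flow_frac x z\<close>.
\<close>

definition flow_mass :: "real \<Rightarrow> real \<Rightarrow> real" where
  "flow_mass x z = 1 - x + x * exp z"

definition flow_frac :: "real \<Rightarrow> real \<Rightarrow> real" where
  "flow_frac x z = x * exp z / flow_mass x z"

lemma flow_mass_pos: "x \<in> {0..1} \<Longrightarrow> 0 < flow_mass x z"
  by (cases "x = 0") (auto simp: flow_mass_def intro: add_nonneg_pos)

lemma flow_mass_0 [simp]: "flow_mass x 0 = 1" and flow_frac_0 [simp]: "flow_frac x 0 = x"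
  by (auto simp: flow_mass_def flow_frac_def)

lemma flow_frac_boundary: "x \<in> {0, 1} \<Longrightarrow> flow_frac x z = x"
  by (auto simp: flow_mass_def flow_frac_def)

lemma flow_mass_frac:
  assumes "x \<in> {0..1}"
  shows "flow_mass x z * flow_frac x z = x * exp z"
    and "flow_mass x z * (1 - flow_frac x z) = 1 - x"
  using flow_mass_pos[OF assms, of z] by (auto simp: flow_frac_def field_simps flow_mass_def)

lemma flow_frac_mem: "x \<in> {0..1} \<Longrightarrow> flow_frac x z \<in> {0..1}"
  using flow_mass_pos[of x z] by (auto simp: flow_frac_def field_simps flow_mass_def)

lemma flow_frac_mem_interior: "x \<in> {0<..<1} \<Longrightarrow> flow_frac x z \<in> {0<..<1}"
  using flow_mass_pos[of x z] by (auto simp: flow_frac_def field_simps flow_mass_def)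

lemma flow_mass_derivative:
  assumes x: "x \<in> {0..1}"
  shows "((\<lambda>z. flow_mass x z powr a) has_real_derivative
           flow_mass x z powr a * (a * flow_frac x z)) (at z)"
proof -
  have "((\<lambda>z. flow_mass x z powr a) has_real_derivative
           a * flow_mass x z powr (a - 1) * (x * exp z)) (at z)"
    using flow_mass_pos[OF x, of z] unfolding flow_mass_def
    by (auto intro!: derivative_eq_intros)
  moreover have "a * flow_mass x z powr (a - 1) * (x * exp z) =
     flow_mass x z powr a * (a * flow_frac x z)"
    using flow_mass_pos[OF x, of z] by (simp add: powr_diff flow_frac_def field_simps)
  ultimately show ?thesis by simp
qed

lemma flow_frac_derivative:
  assumes x: "x \<in> {0..1}"
  shows "(flow_frac x has_real_derivative flow_frac x z * (1 - flow_frac x z)) (at z)"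
proof -
  have p: "flow_mass x z \<noteq> 0" using flow_mass_pos[OF x, of z] by simp
  have m: "(flow_mass x has_real_derivative x * exp z) (at z)"
    unfolding flow_mass_def by (auto intro!: derivative_eq_intros)
  have "((\<lambda>z. x * exp z / flow_mass x z) has_real_derivative
      (x * exp z * flow_mass x z - x * exp z * (x * exp z)) / (flow_mass x z * flow_mass x z)) (at z)"
    by (rule DERIV_divide[OF _ m p]) (auto intro!: derivative_eq_intros)
  moreover have "(x * exp z * flow_mass x z - x * exp z * (x * exp z)) / (flow_mass x z * flow_mass x z)
      = flow_frac x z * (1 - flow_frac x z)"
    using p by (simp add: flow_frac_def field_simps)
  ultimately show ?thesis by (simp add: flow_frac_def[abs_def])
qed

lemma flow_derivative:
  assumes x: "x \<in> {0..1}" and j: "(j has_real_derivative j') (at (flow_frac x z))"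
  shows "((\<lambda>z. flow_mass x z powr a * j (flow_frac x z)) has_real_derivative
           flow_mass x z powr a * (a * flow_frac x z * j (flow_frac x z)
              + flow_frac x z * (1 - flow_frac x z) * j')) (at z)"
  by (rule DERIV_cong[OF DERIV_mult[OF flow_mass_derivative[OF x] DERIV_chain2[OF j flow_frac_derivative[OF x]]]])
    (simp add: algebra_simps)

text \<open>Chain rule bookkeeping: \<open>A * x * U + x * (1 - x) * ux\<close> and the bracket
  multiplied by half of \<sigma> squared are the first two derivatives at \<open>z = 0\<close> of
  the flow's mass to the power \<open>A\<close> times \<open>U\<close> at the flow's fraction. They
  absorb the \<open>Q\<close> term.\<close>

lemma flow_equation_algebra:
  fixes A :: real
  assumes "0 = A * p + x * (1 - x) * (\<mu> - \<gamma> * \<sigma>\<^sup>2 * x) * (A * ux)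
               + \<sigma>\<^sup>2 * x\<^sup>2 * (1 - x)\<^sup>2 / 2 * (A * uxx)
               + (Q \<mu> \<sigma> \<gamma> x - l) * (A * U) + l * (A * m)"
    and A: "A = 1 - \<gamma>" "A \<noteq> 0" and "\<gamma> > 0" "\<sigma> > 0"
  shows "p + (\<mu> - \<sigma>\<^sup>2 / 2) * (A * x * U + x * (1 - x) * ux)
       + \<sigma>\<^sup>2 / 2 * (A * x * (A * x * U + x * (1 - x) * ux)
          + x * (1 - x) * (A * (U + x * ux) + (1 - 2 * x) * ux + x * (1 - x) * uxx))
       + l * (m - U) = 0"
proof -
  define h where "h = \<sigma>\<^sup>2 / 2"
  have \<sigma>: "\<sigma>\<^sup>2 = 2 * h" by (simp add: h_def)
  have \<gamma>: "\<gamma> = 1 - A" using A by simp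
  have Qx: "Q \<mu> \<sigma> \<gamma> x = A * (\<mu> * x - \<gamma> * h * x\<^sup>2)"
  proof -
    define y where "y = y_M \<mu> \<sigma> \<gamma>"
    have "\<mu> = \<gamma> * (2 * h) * y" using assms(4,5) by (simp add: y_def y_M_def flip: \<sigma>)
    moreover have "Q \<mu> \<sigma> \<gamma> x = - (\<gamma> * A * h) * (x - y)\<^sup>2 + \<gamma> * A * h * y\<^sup>2"
      by (simp add: Q_def \<sigma> A flip: y_def)
    ultimately show ?thesis by (simp add: algebra_simps power2_eq_square)
  qed
  have zero: "A * p + x * (1 - x) * (\<mu> - (1 - A) * (2 * h) * x) * (A * ux)
               + h * x\<^sup>2 * (1 - x)\<^sup>2 * (A * uxx)
               + (A * (\<mu> * x - (1 - A) * h * x\<^sup>2) - l) * (A * U) + l * (A * m) = 0"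
    using assms(1)[symmetric] unfolding Qx \<sigma> unfolding \<gamma> by simp
  have "A * (p + (\<mu> - h) * (A * x * U + x * (1 - x) * ux)
       + h * (A * x * (A * x * U + x * (1 - x) * ux)
          + x * (1 - x) * (A * (U + x * ux) + (1 - 2 * x) * ux + x * (1 - x) * uxx))
       + l * (m - U)) = 0"
    by (rule trans[OF _ zero]) (simp add: algebra_simps power2_eq_square)
  then show ?thesis using A(2) by (simp add: h_def)
qed

section \<open>The reduced value function and the wealth factors of trades\<close>

locale hjb =
  fixes \<mu> \<sigma> T lam \<gamma> eb es :: real and v :: "real \<Rightarrow> real \<Rightarrow> real"
  assumes sigma: "\<sigma> > 0" and T: "T > 0" and lam: "lam > 0"
    and gamma: "\<gamma> > 0" "\<gamma> \<noteq> 1" and eb: "eb > 0" and es: "0 < es" "es < 1"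
    and HJB: "solves_HJB \<mu> \<sigma> T lam \<gamma> eb es v"
begin

definition a :: real where "a = 1 - \<gamma>"

lemma a: "a \<noteq> 0" "a < 1"
  using gamma by (auto simp: a_def)

definition u :: "real \<Rightarrow> real \<Rightarrow> real" where "u t x = v t x / a"

text \<open>The wealth kept per unit when trading from fraction \<open>x\<close> to
  \<open>y\<close>: on purchases it solves
  \<open>k * (1 - y) = 1 - x - (1 + eb) * (k * y - x)\<close>, on sales the same with
  \<open>1 - es\<close>.\<close>

definition factor :: "real \<Rightarrow> real \<Rightarrow> real" where
  "factor x y = (if x \<le> y then (1 + eb * x) / (1 + eb * y) else (1 - es * x) / (1 - es * y))"

definition M :: "real \<Rightarrow> real \<Rightarrow> real" where
  "M t x = (SUP y\<in>{0..1}. trade_objective \<gamma> eb es v t x y)"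

lemma a_times_divide: "a * (c / a) = c"
  using a by simp

lemma M_eq: "a * M t x = S \<gamma> eb es v t x"
  by (simp add: S_def M_def a_def)

lemma u_eq: "a * u t x = v t x"
  using a by (simp add: u_def)

lemma objective_eq: "trade_objective \<gamma> eb es v t x y = factor x y powr a * u t y"
  by (simp add: trade_objective_def factor_def u_def a_def)

lemma cost_pos: "x \<in> {0..1} \<Longrightarrow> 0 < 1 + eb * x" "x \<in> {0..1} \<Longrightarrow> 0 < 1 - es * x"
proof -
  assume x: "x \<in> {0..1}"
  then have "0 \<le> eb * x" "es * x \<le> es" using eb es by (auto simp: mult_left_le)
  then show "0 < 1 + eb * x" "0 < 1 - es * x" using es by linarith+
qed

lemma continuous_u: "continuous_on ({0..T} \<times> {0..1}) (\<lambda>(t, x). u t x)"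
proof -
  have "continuous_on ({0..T} \<times> {0..1}) (\<lambda>p. (\<lambda>(t, x). v t x) p / a)"
    using HJB a by (intro continuous_intros) (auto simp: solves_HJB_def)
  then show ?thesis by (simp add: u_def case_prod_beta')
qed

lemma continuous_u_comp:
  assumes "continuous_on A f" "continuous_on A g" "\<And>p. p \<in> A \<Longrightarrow> f p \<in> {0..T} \<and> g p \<in> {0..1}"
  shows "continuous_on A (\<lambda>p. u (f p) (g p))"
proof -
  have "continuous_on A (\<lambda>p. (f p, g p))" using assms by (intro continuous_intros)
  from continuous_on_compose2[OF continuous_u this] show ?thesis using assms(3) by fastforce
qed

lemma terminal_u: "x \<in> {0..1} \<Longrightarrow> u T x = 1 / a"
  using HJB by (auto simp: solves_HJB_def u_def)

text \<open>\<open>factor\<close> is the minimum of the purchase and sale ratios, hence continuous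
  across \<open>y = x\<close>.\<close>

lemma continuous_objective:
  assumes "t \<in> {0..T}" "x \<in> {0..1}"
  shows "continuous_on {0..1} (\<lambda>y. trade_objective \<gamma> eb es v t x y)"
proof -
  have eq: "factor x y = min ((1 + eb * x) / (1 + eb * y)) ((1 - es * x) / (1 - es * y))"
    if y: "y \<in> {0..1}" for y
  proof -
    have "(1 + eb * x) / (1 + eb * y) \<le> (1 - es * x) / (1 - es * y) \<longleftrightarrow> (eb + es) * x \<le> (eb + es) * y"
      using cost_pos[OF y] by (simp add: field_simps)
    also have "\<dots> \<longleftrightarrow> x \<le> y" using eb es by (subst mult_le_cancel_left_pos) auto
    finally show ?thesis by (auto simp: factor_def min_def)
  qed
  have "continuous_on {0..1} (\<lambda>y. min ((1 + eb * x) / (1 + eb * y)) ((1 - es * x) / (1 - es * y)) powr a * u t y)"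
  proof (intro continuous_on_mult continuous_on_powr continuous_on_min continuous_on_divide
      continuous_u_comp continuous_on_const continuous_on_id continuous_on_add continuous_on_diff ballI)
    fix y :: real assume y: "y \<in> {0..1}"
    show "1 + eb * y \<noteq> 0" "1 - es * y \<noteq> 0" using cost_pos[OF y] by auto
    show "min ((1 + eb * x) / (1 + eb * y)) ((1 - es * x) / (1 - es * y)) \<noteq> 0"
      using cost_pos[OF y] cost_pos[OF assms(2)] by (auto simp: min_def)
    show "t \<in> {0..T} \<and> y \<in> {0..1}" using assms y by simp
  qed
  then show ?thesis
    by (rule continuous_on_eq) (simp add: objective_eq eq)
qed

lemma M_attained:
  assumes "t \<in> {0..T}" "x \<in> {0..1}"
  obtains y where "y \<in> {0..1}" "M t x = factor x y powr a * u t y"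
proof -
  obtain y where y: "y \<in> {0..1}"
     "\<forall>z\<in>{0..1}. trade_objective \<gamma> eb es v t x z \<le> trade_objective \<gamma> eb es v t x y"
    using continuous_attains_sup[OF _ _ continuous_objective[OF assms]] by auto
  then have "M t x = trade_objective \<gamma> eb es v t x y"
    unfolding M_def by (intro cSup_eq_maximum) auto
  with y that show ?thesis by (auto simp: objective_eq)
qed

lemma M_upper:
  assumes "t \<in> {0..T}" "x \<in> {0..1}" "y \<in> {0..1}"
  shows "factor x y powr a * u t y \<le> M t x"
proof -
  have "bdd_above ((\<lambda>y. trade_objective \<gamma> eb es v t x y) ` {0..1})"
    using compact_continuous_image[OF continuous_objective[OF assms(1,2)]]
    by (intro bounded_imp_bdd_above compact_imp_bounded) auto
  from cSUP_upper[OF assms(3) this] show ?thesis by (simp add: M_def objective_eq)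
qed

lemma factor_bounds:
  assumes x: "x \<in> {0..1}" and y: "y \<in> {0..1}"
  shows "(1 - es) / (1 + eb) \<le> factor x y" "factor x y \<le> 1" "0 < factor x y"
proof -
  have i: "es * x \<le> es" "eb * y \<le> eb" "0 \<le> eb * x" "0 \<le> es * y" "0 \<le> eb * y"
    using x y eb es by (auto simp: mult_left_le)
  show le: "(1 - es) / (1 + eb) \<le> factor x y"
  proof (cases "x \<le> y")
    case True
    have "(1 - es) / (1 + eb) \<le> (1 + eb * x) / (1 + eb * y)"
      using i es by (intro frac_le) auto
    with True show ?thesis by (simp add: factor_def)
  next
    case False
    have "(1 - es) / (1 + eb) \<le> (1 - es * x) / (1 - es * y)"
      using i es eb cost_pos[OF y] cost_pos[OF x] by (intro frac_le; linarith)
    with False show ?thesis by (simp add: factor_def)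
  qed
  have "0 < (1 - es) / (1 + eb)" using eb es by auto
  with le show "0 < factor x y" by linarith
  show "factor x y \<le> 1" using cost_pos[OF y] eb es by (auto simp: factor_def)
qed

text \<open>A bound for powers of \<open>factor\<close>: these increase in the factor for
  \<open>a > 0\<close>, where 1 bounds them, and decrease for \<open>a < 0\<close>, where the lower
  bound of the factor is decisive.\<close>

definition C :: real where "C = max 1 (((1 - es) / (1 + eb)) powr a)"

lemma factor_powr_le:
  assumes "x \<in> {0..1}" "y \<in> {0..1}"
  shows "factor x y powr a \<le> C"
proof (cases "a > 0")
  case True
  then show ?thesis using factor_bounds[OF assms] powr_mono2[of a "factor x y" 1] by (simp add: C_def)
next
  case False
  then have "factor x y powr a \<le> ((1 - es) / (1 + eb)) powr a"
    using factor_bounds[OF assms] eb es by (intro powr_mono2') auto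
  then show ?thesis by (simp add: C_def)
qed

section \<open>The HJB equation along the flow\<close>

text \<open>
  Along the flow the HJB equation has constant coefficients and no zeroth-order term apart from the
  jumps, and it takes the same form at the endpoints \<open>x = 0\<close> and \<open>x = 1\<close>.
\<close>

lemma flow_equation:
  assumes t: "t \<in> {0..T}" and x: "x \<in> {0..1}"
  obtains d f' f'' where "((\<lambda>s. u s x) has_real_derivative d) (at t within {0..T})"
    "\<And>z. ((\<lambda>z. flow_mass x z powr a * u t (flow_frac x z)) has_real_derivative f' z) (at z)"
    "(f' has_real_derivative f'') (at 0)"
    "d + (\<mu> - \<sigma>\<^sup>2 / 2) * f' 0 + \<sigma>\<^sup>2 / 2 * f'' + lam * (M t x - u t x) = 0"
proof (cases "x \<in> {0, 1}")
  case True
  obtain w where w: "((\<lambda>s. v s x) has_real_derivative w) (at t within {0..T})"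
     "0 = w + (Q \<mu> \<sigma> \<gamma> x - lam) * v t x + lam * S \<gamma> eb es v t x"
    using HJB True t unfolding solves_HJB_def by blast
  have D: "((\<lambda>z. flow_mass x z powr a * c) has_real_derivative
     flow_mass x z powr a * (a * x * c)) (at z)" for c z
    using flow_derivative[OF x, of "\<lambda>_. c" 0 z a] flow_frac_boundary[OF True] by simp
  \<comment> \<open>The coefficients of the derivatives in \<open>x\<close> vanish at the endpoints,
    so setting these to 0 puts the boundary equation into the interior form.\<close>
  have "0 = a * (w / a) + x * (1 - x) * (\<mu> - \<gamma> * \<sigma>\<^sup>2 * x) * (a * 0)
               + \<sigma>\<^sup>2 * x\<^sup>2 * (1 - x)\<^sup>2 / 2 * (a * 0)
               + (Q \<mu> \<sigma> \<gamma> x - lam) * (a * u t x) + lam * (a * M t x)"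
    unfolding mult_zero_right add_0_right a_times_divide M_eq u_eq by (rule w(2))
  from flow_equation_algebra[OF this a_def a(1) gamma(1) sigma] have eq: "w / a + (\<mu> - \<sigma>\<^sup>2 / 2) * (a * x * u t x)
      + \<sigma>\<^sup>2 / 2 * (a * x * (a * x * u t x)) + lam * (M t x - u t x) = 0"
    using True by auto
  show ?thesis
  proof (rule that)
    show "((\<lambda>s. u s x) has_real_derivative w / a) (at t within {0..T})"
      unfolding u_def by (rule DERIV_cdivide[OF w(1)])
    show "((\<lambda>z. flow_mass x z powr a * u t (flow_frac x z)) has_real_derivative
       flow_mass x z powr a * (a * x * u t x)) (at z)" for z
      using D[of "u t x"] flow_frac_boundary[OF True] by simp
    show "((\<lambda>z. flow_mass x z powr a * (a * x * u t x)) has_real_derivative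
       a * x * (a * x * u t x)) (at 0)"
      using D[of "a * x * u t x" 0] by simp
  qed (use eq in simp)
next
  case False
  with x have x': "x \<in> {0<..<1}" by auto
  obtain vt vx vxx where c: "C12_with T v vt vx vxx" and pde: 
      "\<forall>t\<in>{0..T}. \<forall>x\<in>{0<..<1}.
           0 = vt t x + x * (1 - x) * (\<mu> - \<gamma> * \<sigma>\<^sup>2 * x) * vx t x
               + \<sigma>\<^sup>2 * x\<^sup>2 * (1 - x)\<^sup>2 / 2 * vxx t x
               + (Q \<mu> \<sigma> \<gamma> x - lam) * v t x + lam * S \<gamma> eb es v t x"
    using HJB unfolding solves_HJB_def by blast
  have dt: "((\<lambda>s. v s x) has_real_derivative vt t x) (at t within {0..T})"
    using c t x' unfolding C12_with_def by blast
  have dx: "((\<lambda>z. v t z) has_real_derivative vx t y) (at y)"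
    and dxx: "((\<lambda>z. vx t z) has_real_derivative vxx t y) (at y)" if "y \<in> {0<..<1}" for y
    using c t that unfolding C12_with_def by blast+
  \<comment> \<open>One derivative of \<open>u t\<close> along the flow gives \<open>k\<close>, up
    to the mass power; the same rule applied to \<open>k\<close> gives the second
    derivative.\<close>
  define k where "k y = a * y * u t y + y * (1 - y) * (vx t y / a)" for y
  define k' where "k' = a * (u t x + x * (vx t x / a)) + (1 - 2 * x) * (vx t x / a) + x * (1 - x) * (vxx t x / a)"
  have du: "((\<lambda>z. u t z) has_real_derivative vx t y / a) (at y)" if "y \<in> {0<..<1}" for y
    unfolding u_def by (rule DERIV_cdivide[OF dx[OF that]])
  have dvx: "((\<lambda>z. vx t z / a) has_real_derivative vxx t x / a) (at x)"
    by (rule DERIV_cdivide[OF dxx[OF x']])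
  have dk: "(k has_real_derivative k') (at x)"
    unfolding k_def[abs_def] k'_def
    by (rule dvx du x' derivative_eq_intros refl)+ (simp add: algebra_simps)
  show ?thesis
  proof (rule that)
    show "((\<lambda>s. u s x) has_real_derivative vt t x / a) (at t within {0..T})"
      unfolding u_def by (rule DERIV_cdivide[OF dt])
    show "((\<lambda>z. flow_mass x z powr a * u t (flow_frac x z)) has_real_derivative
       flow_mass x z powr a * k (flow_frac x z)) (at z)" for z
      using flow_derivative[OF x du[OF flow_frac_mem_interior[OF x']], where a = a] by (simp add: k_def)
    show "((\<lambda>z. flow_mass x z powr a * k (flow_frac x z)) has_real_derivative
       a * x * k x + x * (1 - x) * k') (at 0)"
      using flow_derivative[OF x, of k k' 0 a] dk by simp
    have "0 = a * (vt t x / a) + x * (1 - x) * (\<mu> - \<gamma> * \<sigma>\<^sup>2 * x) * (a * (vx t x / a))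
               + \<sigma>\<^sup>2 * x\<^sup>2 * (1 - x)\<^sup>2 / 2 * (a * (vxx t x / a))
               + (Q \<mu> \<sigma> \<gamma> x - lam) * (a * u t x) + lam * (a * M t x)"
      unfolding a_times_divide M_eq u_eq by (rule pde[rule_format, OF t x'])
    from flow_equation_algebra[OF this a_def a(1) gamma(1) sigma]
    show "vt t x / a + (\<mu> - \<sigma>\<^sup>2 / 2) * (flow_mass x 0 powr a * k (flow_frac x 0)) +
      \<sigma>\<^sup>2 / 2 * (a * x * k x + x * (1 - x) * k') + lam * (M t x - u t x) = 0"
      by (simp add: k_def k'_def)
  qed
qed

text \<open>\<open>Q\<close> is the generator of the flow applied to
  \<open>flow_mass x z powr a\<close> at \<open>z = 0\<close>: the constant \<open>U = 1\<close>
  without jumps fits the algebraic identity with \<open>p = - Q\<close>.\<close>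

lemma Q_eq:
  "Q \<mu> \<sigma> \<gamma> x = (\<mu> - \<sigma>\<^sup>2 / 2) * (a * x) + \<sigma>\<^sup>2 / 2 * (a * x * (a * x) + x * (1 - x) * a)"
  using flow_equation_algebra[of a "- Q \<mu> \<sigma> \<gamma> x" x \<mu> \<gamma> \<sigma> 0 0 0 1 0] a gamma sigma
  by (simp add: a_def)

lemma Q_bound:
  obtains B where "0 \<le> B" "\<And>x. x \<in> {0..1} \<Longrightarrow> \<bar>Q \<mu> \<sigma> \<gamma> x\<bar> \<le> B"
proof -
  have "continuous_on {0..1} (Q \<mu> \<sigma> \<gamma>)"
    unfolding Q_def by (intro continuous_intros)
  then have "bounded (Q \<mu> \<sigma> \<gamma> ` {0..1})"
    using compact_continuous_image compact_imp_bounded by blast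
  then obtain B where B: "0 < B" "\<forall>x\<in>Q \<mu> \<sigma> \<gamma> ` {0..1}. norm x \<le> B"
    unfolding bounded_pos by blast
  show ?thesis by (rule that[of B]) (use B in auto)
qed

text \<open>
  First and second order conditions at the minimum of \<open>\<Sum> c\<^sub>i U(x\<^sub>i) - W (flow_mass x\<^sub>0)\<^sup>a\<close> along the
  flow; the subtracted power accounts for renormalizing \<open>x\<^sub>0\<close> to unit wealth, and its
  contribution is exactly the term with \<open>Q\<close>.
\<close>

lemma generator_minimum:
  assumes t: "t \<in> {0..T}" and x: "x0 \<in> {0..1}" "x1 \<in> {0..1}" "x2 \<in> {0..1}"
    and W: "W = c0 * u t x0 + c1 * u t x1 + c2 * u t x2"
    and ge: "\<And>z. W * flow_mass x0 z powr a \<le>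
       c0 * (flow_mass x0 z powr a * u t (flow_frac x0 z))
       + c1 * (flow_mass x1 z powr a * u t (flow_frac x1 z))
       + c2 * (flow_mass x2 z powr a * u t (flow_frac x2 z))"
  obtains d where
    "((\<lambda>s. c0 * u s x0 + c1 * u s x1 + c2 * u s x2) has_real_derivative d) (at t within {0..T})"
    "d + lam * (c0 * M t x0 + c1 * M t x1 + c2 * M t x2 - W) + Q \<mu> \<sigma> \<gamma> x0 * W \<le> 0"
proof -
  obtain d0 f0' f0'' where 0: "((\<lambda>s. u s x0) has_real_derivative d0) (at t within {0..T})"
    "\<And>z. ((\<lambda>z. flow_mass x0 z powr a * u t (flow_frac x0 z)) has_real_derivative f0' z) (at z)"
    "(f0' has_real_derivative f0'') (at 0)"
    "d0 + (\<mu> - \<sigma>\<^sup>2 / 2) * f0' 0 + \<sigma>\<^sup>2 / 2 * f0'' + lam * (M t x0 - u t x0) = 0"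
    using flow_equation[OF t x(1)] by blast
  obtain d1 f1' f1'' where 1: "((\<lambda>s. u s x1) has_real_derivative d1) (at t within {0..T})"
    "\<And>z. ((\<lambda>z. flow_mass x1 z powr a * u t (flow_frac x1 z)) has_real_derivative f1' z) (at z)"
    "(f1' has_real_derivative f1'') (at 0)"
    "d1 + (\<mu> - \<sigma>\<^sup>2 / 2) * f1' 0 + \<sigma>\<^sup>2 / 2 * f1'' + lam * (M t x1 - u t x1) = 0"
    using flow_equation[OF t x(2)] by blast
  obtain d2 f2' f2'' where 2: "((\<lambda>s. u s x2) has_real_derivative d2) (at t within {0..T})"
    "\<And>z. ((\<lambda>z. flow_mass x2 z powr a * u t (flow_frac x2 z)) has_real_derivative f2' z) (at z)"
    "(f2' has_real_derivative f2'') (at 0)"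
    "d2 + (\<mu> - \<sigma>\<^sup>2 / 2) * f2' 0 + \<sigma>\<^sup>2 / 2 * f2'' + lam * (M t x2 - u t x2) = 0"
    using flow_equation[OF t x(3)] by blast
  define m' where "m' z = flow_mass x0 z powr a * (a * flow_frac x0 z)" for z
  define m'' where "m'' = a * x0 * (a * x0) + x0 * (1 - x0) * a"
  have m': "((\<lambda>z. flow_mass x0 z powr a) has_real_derivative m' z) (at z)" for z
    unfolding m'_def by (rule flow_mass_derivative[OF x(1)])
  have "((\<lambda>y. a * y) has_real_derivative a) (at x0)"
    by (auto intro!: derivative_eq_intros)
  from flow_derivative[OF x(1), of "\<lambda>y. a * y" a 0 a] this
  have m'': "(m' has_real_derivative m'') (at 0)"
    unfolding m'_def[abs_def] m''_def by simp
  define h where "h z = c0 * (flow_mass x0 z powr a * u t (flow_frac x0 z))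
       + c1 * (flow_mass x1 z powr a * u t (flow_frac x1 z))
       + c2 * (flow_mass x2 z powr a * u t (flow_frac x2 z)) - W * flow_mass x0 z powr a" for z
  define h' where "h' z = c0 * f0' z + c1 * f1' z + c2 * f2' z - W * m' z" for z
  define h'' where "h'' = c0 * f0'' + c1 * f1'' + c2 * f2'' - W * m''"
  have dh: "(h has_real_derivative h' z) (at z)" for z
    unfolding h_def[abs_def] h'_def
    by (intro DERIV_diff DERIV_add DERIV_cmult 0 1 2 m')
  have dh': "(h' has_real_derivative h'') (at 0)"
    unfolding h'_def[abs_def] h''_def
    by (intro DERIV_diff DERIV_add DERIV_cmult 0 1 2 m'')
  have "h 0 \<le> h z" for z using ge[of z] W by (simp add: h_def)
  note min = second_order_minimum[OF dh dh' this]
  have first: "c0 * f0' 0 + c1 * f1' 0 + c2 * f2' 0 = W * (a * x0)"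
    using min(1) by (simp add: h'_def m'_def)
  have second: "0 \<le> \<sigma>\<^sup>2 / 2 * h''" using min(2) by simp
  show ?thesis
  proof (rule that)
    show "((\<lambda>s. c0 * u s x0 + c1 * u s x1 + c2 * u s x2) has_real_derivative
        c0 * d0 + c1 * d1 + c2 * d2) (at t within {0..T})"
      by (intro DERIV_add DERIV_cmult 0 1 2)
    have "c0 * (d0 + (\<mu> - \<sigma>\<^sup>2 / 2) * f0' 0 + \<sigma>\<^sup>2 / 2 * f0'' + lam * (M t x0 - u t x0))
      + c1 * (d1 + (\<mu> - \<sigma>\<^sup>2 / 2) * f1' 0 + \<sigma>\<^sup>2 / 2 * f1'' + lam * (M t x1 - u t x1))
      + c2 * (d2 + (\<mu> - \<sigma>\<^sup>2 / 2) * f2' 0 + \<sigma>\<^sup>2 / 2 * f2'' + lam * (M t x2 - u t x2)) = 0"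
      unfolding 0 1 2 by simp
    moreover have "c0 * (d0 + (\<mu> - \<sigma>\<^sup>2 / 2) * f0' 0 + \<sigma>\<^sup>2 / 2 * f0'' + lam * (M t x0 - u t x0))
      + c1 * (d1 + (\<mu> - \<sigma>\<^sup>2 / 2) * f1' 0 + \<sigma>\<^sup>2 / 2 * f1'' + lam * (M t x1 - u t x1))
      + c2 * (d2 + (\<mu> - \<sigma>\<^sup>2 / 2) * f2' 0 + \<sigma>\<^sup>2 / 2 * f2'' + lam * (M t x2 - u t x2))
      = c0 * d0 + c1 * d1 + c2 * d2
        + (\<mu> - \<sigma>\<^sup>2 / 2) * (c0 * f0' 0 + c1 * f1' 0 + c2 * f2' 0)
        + \<sigma>\<^sup>2 / 2 * (h'' + W * m'')
        + lam * (c0 * M t x0 + c1 * M t x1 + c2 * M t x2 - W)"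
      unfolding W h''_def by (simp add: algebra_simps add_divide_distrib diff_divide_distrib)
    moreover have "Q \<mu> \<sigma> \<gamma> x0 * W = (\<mu> - \<sigma>\<^sup>2 / 2) * (W * (a * x0)) + \<sigma>\<^sup>2 / 2 * (W * m'')"
      unfolding Q_eq m''_def by (simp add: algebra_simps add_divide_distrib diff_divide_distrib)
    ultimately show "c0 * d0 + c1 * d1 + c2 * d2
       + lam * (c0 * M t x0 + c1 * M t x1 + c2 * M t x2 - W) + Q \<mu> \<sigma> \<gamma> x0 * W \<le> 0"
      using second unfolding first distrib_left by linarith
  qed
qed

section \<open>The sign of the value function for a negative exponent\<close>

text \<open>Maximum principle for \<open>u + \<beta>\<close>: the positive barrier
  \<open>\<beta>\<close> cancels \<open>u\<close> at time \<open>T\<close> and decays backwards in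
  time, and \<open>u \<le> - \<beta>\<close> gives the strict sign.\<close>

lemma u_negative:
  assumes neg: "a < 0" and "t \<in> {0..T}" "x \<in> {0..1}"
  shows "u t x < 0"
proof -
  obtain B where B: "0 \<le> B" "\<And>x. x \<in> {0..1} \<Longrightarrow> \<bar>Q \<mu> \<sigma> \<gamma> x\<bar> \<le> B" by (rule Q_bound) blast
  \<comment> \<open>Large enough for both brackets at the end: \<open>K - lam * C + lam - Q\<close>,
    multiplying \<open>w\<close>, and \<open>K - lam + Q\<close>, multiplying
    \<open>\<beta>\<close>.\<close>
  define K where "K = lam + lam * C + B + 1"
  define \<beta> where "\<beta> s = - (1 / a) * exp (- K * (T - s))" for s
  have \<beta>: "0 < \<beta> s" for s using neg by (simp add: \<beta>_def divide_pos_neg)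
  have \<beta>T: "\<beta> T = - (1 / a)" by (simp add: \<beta>_def)
  define G where "G s y = exp (K * s) * (u s y + \<beta> s)" for s y
  have "continuous_on ({0..T} \<times> {0..1}) (\<lambda>p. G (fst p) (snd p))"
    unfolding G_def \<beta>_def by (intro continuous_intros continuous_u_comp) auto
  from continuous_attains_sup[OF _ _ this]
  obtain t0 x0 where tx: "t0 \<in> {0..T}" "x0 \<in> {0..1}"
     and max: "\<And>s y. s \<in> {0..T} \<Longrightarrow> y \<in> {0..1} \<Longrightarrow> G s y \<le> G t0 x0"
    using T by (fastforce simp: compact_Times)
  define w where "w = u t0 x0 + \<beta> t0"
  have "w \<le> 0"
  proof (rule ccontr)
    assume "\<not> w \<le> 0"
    then have w: "w > 0" by simp
    then have "t0 \<noteq> T" using terminal_u[OF tx(2)] by (auto simp: w_def \<beta>T)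
    with tx have tT: "t0 < T" by auto
    have umax: "u t0 y \<le> u t0 x0" if "y \<in> {0..1}" for y
      using max[OF tx(1) that] by (simp add: G_def)
    have ge: "- u t0 x0 * flow_mass x0 z powr a \<le>
       -1 * (flow_mass x0 z powr a * u t0 (flow_frac x0 z))
       + 0 * (flow_mass x0 z powr a * u t0 (flow_frac x0 z))
       + 0 * (flow_mass x0 z powr a * u t0 (flow_frac x0 z))" for z
      using mult_left_mono[OF umax[OF flow_frac_mem[OF tx(2)], of z], of "flow_mass x0 z powr a"]
      by (simp add: mult.commute)
    obtain d where d: "((\<lambda>s. -1 * u s x0 + 0 * u s x0 + 0 * u s x0) has_real_derivative d) (at t0 within {0..T})"
      "d + lam * (-1 * M t0 x0 + 0 * M t0 x0 + 0 * M t0 x0 - - u t0 x0) + Q \<mu> \<sigma> \<gamma> x0 * - u t0 x0 \<le> 0"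
      by (rule generator_minimum[OF tx(1) tx(2) tx(2) tx(2) _ ge]) auto
    have du: "((\<lambda>s. - u s x0) has_real_derivative d) (at t0 within {0..T})" using d(1) by simp
    have "((\<lambda>s. exp (K * s) * (- u s x0 - \<beta> s)) has_real_derivative
        exp (K * t0) * (- (K * w) + d - K * \<beta> t0)) (at t0 within {0..T})"
      unfolding \<beta>_def
      by (rule derivative_eq_intros du refl)+ (simp add: w_def \<beta>_def algebra_simps)
    then have "0 \<le> exp (K * t0) * (- (K * w) + d - K * \<beta> t0)"
      by (rule right_minimum_derivative) (use tx tT max[OF _ tx(2)] in \<open>auto simp: G_def algebra_simps\<close>)
    then have dK: "K * w + K * \<beta> t0 \<le> d" by (simp add: zero_le_mult_iff)
    obtain y where y: "y \<in> {0..1}" "M t0 x0 = factor x0 y powr a * u t0 y"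
      by (rule M_attained[OF tx])
    have "factor x0 y powr a * u t0 y \<le> factor x0 y powr a * w"
      using umax[OF y(1)] \<beta>[of t0] by (intro mult_left_mono) (auto simp: w_def)
    also have "\<dots> \<le> C * w" using factor_powr_le[OF tx(2) y(1)] w by (intro mult_right_mono) auto
    finally have MC: "lam * M t0 x0 \<le> lam * (C * w)" using y(2) lam by simp
    have "0 < C" by (simp add: C_def)
    then have "0 < lam * C" using lam by simp
    then have "0 < K - lam * C + lam - Q \<mu> \<sigma> \<gamma> x0" "0 < K - lam + Q \<mu> \<sigma> \<gamma> x0"
      unfolding K_def using B(2)[OF tx(2)] lam by linarith+
    then have "0 < w * (K - lam * C + lam - Q \<mu> \<sigma> \<gamma> x0)" "0 < \<beta> t0 * (K - lam + Q \<mu> \<sigma> \<gamma> x0)"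
      using w \<beta>[of t0] by simp_all
    moreover have "d + lam * (w - \<beta> t0) - lam * M t0 x0 - Q \<mu> \<sigma> \<gamma> x0 * (w - \<beta> t0) \<le> 0"
      using d(2) by (simp add: w_def algebra_simps)
    ultimately show False using dK MC by (simp add: algebra_simps)
  qed
  then have "G t0 x0 \<le> 0" by (simp add: G_def w_def mult_nonneg_nonpos)
  with max[OF assms(2,3)] have "G t x \<le> 0" by simp
  with \<beta>[of t] show ?thesis by (simp add: G_def mult_le_0_iff)
qed

section \<open>Trades and the budget constraint\<close>

text \<open>The cash needed to move the stock position from \<open>x\<close> to \<open>q\<close> is the maximum of
  \<open>(1 + eb) (q - x)\<close> and \<open>(1 - es) (q - x)\<close>; stating both bounds separately keeps the budget
  constraint linear, so that it passes to convex combinations.\<close>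

lemma factor_budget:
  assumes x: "x \<in> {0..1}" and y: "y \<in> {0..1}"
  shows "factor x y * (1 - y) \<le> 1 - x - (1 + eb) * (factor x y * y - x)"
    and "factor x y * (1 - y) \<le> 1 - x - (1 - es) * (factor x y * y - x)"
proof -
  let ?k = "factor x y"
  have "?k * (1 - y) \<le> 1 - x - (1 + eb) * (?k * y - x) \<and> ?k * (1 - y) \<le> 1 - x - (1 - es) * (?k * y - x)"
  proof (cases "x \<le> y")
    case True
    then have k: "?k * (1 + eb * y) = 1 + eb * x"
      using cost_pos[OF y] by (simp add: factor_def)
    then have "eb * (?k * y - x) = 1 - ?k" by (simp add: algebra_simps)
    with factor_bounds(2)[OF x y] have "0 \<le> eb * (?k * y - x)" by simp
    then have "0 \<le> ?k * y - x" using eb by (simp add: zero_le_mult_iff)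
    \<comment> \<open>The price in force is met with equality. The stock bought is nonnegative, so
      the lower price gives the weaker bound; the sale case is symmetric.\<close>
    then have "(1 - es) * (?k * y - x) \<le> (1 + eb) * (?k * y - x)"
      using es eb by (intro mult_right_mono) auto
    with k show ?thesis by (simp add: algebra_simps)
  next
    case False
    then have k: "?k * (1 - es * y) = 1 - es * x"
      using cost_pos[OF y] by (simp add: factor_def)
    then have "es * (?k * y - x) = ?k - 1" by (simp add: algebra_simps)
    with factor_bounds(2)[OF x y] have "es * (?k * y - x) \<le> 0" by simp
    then have "?k * y - x \<le> 0" using es by (simp add: mult_le_0_iff)
    then have "(1 + eb) * (?k * y - x) \<le> (1 - es) * (?k * y - x)"
      using es eb by (intro mult_right_mono_neg) auto
    with k show ?thesis by (simp add: algebra_simps)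
  qed
  then show "?k * (1 - y) \<le> 1 - x - (1 + eb) * (?k * y - x)"
    and "?k * (1 - y) \<le> 1 - x - (1 - es) * (?k * y - x)" by auto
qed

text \<open>Converse of \<open>factor_budget\<close>: spending the whole budget on reaching stock
  \<open>q\<close> leaves at least cash \<open>p\<close>. Here \<open>k\<close> is the total wealth
  then held and \<open>y = q / k\<close> its stock fraction.\<close>

lemma budget_factor:
  assumes x: "x \<in> {0..1}" and pq: "0 \<le> p" "0 \<le> q"
    and buy: "p \<le> 1 - x - (1 + eb) * (q - x)" and sell: "p \<le> 1 - x - (1 - es) * (q - x)"
  obtains y where "y \<in> {0..1}" "p \<le> factor x y * (1 - y)" "factor x y * y = q"
proof (cases "x \<le> q")
  case True
  define k where "k = 1 - x - (1 + eb) * (q - x) + q"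
  have k1: "k = 1 - eb * (q - x)" by (simp add: k_def algebra_simps)
  have kq: "q \<le> k" using pq buy by (simp add: k_def)
  have k: "0 < k" using kq pq x True by (cases "q = 0") (auto simp: k_def)
  have kle: "k \<le> 1" using True eb by (simp add: k1)
  define y where "y = q / k"
  have ky: "k * y = q" using k by (simp add: y_def)
  have y: "y \<in> {0..1}" using k kq pq by (auto simp: y_def)
  have "x \<le> y" using True ky mult_right_mono[OF kle, of y] y by auto
  have "k * (1 + eb * y) = k + eb * (k * y)" by (simp add: algebra_simps)
  also have "\<dots> = 1 + eb * x" unfolding ky using k1 by (simp add: algebra_simps)
  finally have f: "factor x y = k"
    using cost_pos[OF y] \<open>x \<le> y\<close> by (simp add: factor_def divide_eq_eq)
  show ?thesis
    by (rule that[OF y]) (use f ky buy in \<open>simp_all add: right_diff_distrib k_def\<close>)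
next
  case False
  define k where "k = 1 - x - (1 - es) * (q - x) + q"
  have k1: "k = 1 - es * (x - q)" by (simp add: k_def algebra_simps)
  have kq: "q \<le> k" using pq sell by (simp add: k_def)
  have "es * (x - q) \<le> es * 1" using x es pq by (intro mult_left_mono) auto
  then have k: "0 < k" unfolding k1 using es by linarith
  define y where "y = q / k"
  have ky: "k * y = q" using k by (simp add: y_def)
  have y: "y \<in> {0..1}" using k kq pq by (auto simp: y_def)
  have "k * (1 - es * y) = k - es * (k * y)" by (simp add: algebra_simps)
  also have "\<dots> = 1 - es * x" unfolding ky using k1 by (simp add: algebra_simps)
  finally have eq: "k * (1 - es * y) = 1 - es * x" .
  have "k < 1" using False es by (simp add: k1)
  \<comment> \<open>The case split compares \<open>x\<close> with the stock \<open>q\<close>, but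
    \<open>factor\<close> compares it with the fraction \<open>y\<close>; \<open>x \<le> y\<close>
    would contradict \<open>k < 1\<close>.\<close>
  have "\<not> x \<le> y"
  proof
    assume "x \<le> y"
    then have "1 - es * y \<le> 1 - es * x" using es by simp
    moreover have "k * (1 - es * y) < 1 * (1 - es * y)"
      using \<open>k < 1\<close> cost_pos[OF y] by (intro mult_strict_right_mono) auto
    ultimately show False using eq by simp
  qed
  then have f: "factor x y = k"
    using cost_pos[OF y] eq by (simp add: factor_def divide_eq_eq)
  show ?thesis
    by (rule that[OF y]) (use f ky sell in \<open>simp_all add: right_diff_distrib k_def\<close>)
qed

section \<open>Stability of the constraint set under the flow and under trades\<close>

text \<open>With \<open>r = (1 - x0, x0)\<close>, \<open>p = w1 (1 - x1, x1)\<close> and \<open>q = w2 (1 - x2, x2)\<close> this says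
  \<open>r \<ge> \<theta> p + (1 - \<theta>) q\<close> componentwise.\<close>

definition feasible :: "real \<Rightarrow> real \<Rightarrow> real \<Rightarrow> real \<Rightarrow> real \<Rightarrow> real \<Rightarrow> bool" where
  "feasible \<theta> x0 w1 x1 w2 x2 \<longleftrightarrow>
     \<theta> * (w1 * (1 - x1)) + (1 - \<theta>) * (w2 * (1 - x2)) \<le> 1 - x0 \<and>
     \<theta> * (w1 * x1) + (1 - \<theta>) * (w2 * x2) \<le> x0"

text \<open>The flow leaves cash alone and multiplies all stock by \<open>exp z\<close>, so both
  inequalities survive; dividing by \<open>flow_mass x0 z\<close> restores unit wealth of the first
  position.\<close>

lemma feasible_flow:
  assumes x: "x0 \<in> {0..1}" "x1 \<in> {0..1}" "x2 \<in> {0..1}" and f: "feasible \<theta> x0 w1 x1 w2 x2"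
  shows "feasible \<theta> (flow_frac x0 z) (w1 * flow_mass x1 z / flow_mass x0 z) (flow_frac x1 z)
     (w2 * flow_mass x2 z / flow_mass x0 z) (flow_frac x2 z)"
proof -
  note p = flow_mass_pos[OF x(1), of z]
  have "\<theta> * (w1 * x1) * exp z + (1 - \<theta>) * (w2 * x2) * exp z \<le> x0 * exp z"
    using f mult_right_mono[of "\<theta> * (w1 * x1) + (1 - \<theta>) * (w2 * x2)" x0 "exp z"]
    by (simp add: feasible_def distrib_right)
  then have "\<theta> * (w1 * (x1 * exp z)) + (1 - \<theta>) * (w2 * (x2 * exp z)) \<le> x0 * exp z"
    by (simp add: mult.assoc)
  moreover have "\<theta> * (w1 * (1 - x1)) + (1 - \<theta>) * (w2 * (1 - x2)) \<le> 1 - x0"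
    using f by (simp add: feasible_def)
  ultimately have
    "(\<theta> * (w1 * (flow_mass x1 z * flow_frac x1 z)) + (1 - \<theta>) * (w2 * (flow_mass x2 z * flow_frac x2 z)))
        / flow_mass x0 z \<le> flow_mass x0 z * flow_frac x0 z / flow_mass x0 z"
    "(\<theta> * (w1 * (flow_mass x1 z * (1 - flow_frac x1 z))) + (1 - \<theta>) * (w2 * (flow_mass x2 z * (1 - flow_frac x2 z))))
        / flow_mass x0 z \<le> flow_mass x0 z * (1 - flow_frac x0 z) / flow_mass x0 z"
    unfolding flow_mass_frac[OF x(1)] flow_mass_frac[OF x(2)] flow_mass_frac[OF x(3)]
    using p by (auto intro!: divide_right_mono)
  then show ?thesis
    unfolding feasible_def using p by (simp add: add_divide_distrib mult.assoc)
qed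

text \<open>The combination \<open>(b, q)\<close> of the two traded positions meets both linear
  budget constraints from \<open>x0\<close>, so a trade from \<open>x0\<close> reaches stock
  \<open>q\<close> with at least cash \<open>b\<close>.\<close>

lemma feasible_trade:
  assumes x: "x0 \<in> {0..1}" "x1 \<in> {0..1}" "x2 \<in> {0..1}" and f: "feasible \<theta> x0 w1 x1 w2 x2"
    and y: "y1 \<in> {0..1}" "y2 \<in> {0..1}" and \<theta>: "0 \<le> \<theta>" "\<theta> \<le> 1" and w: "0 \<le> w1" "0 \<le> w2"
  obtains y0 where "y0 \<in> {0..1}" "feasible \<theta> y0 (w1 * factor x1 y1 / factor x0 y0) y1
     (w2 * factor x2 y2 / factor x0 y0) y2"
proof -
  define b where "b = \<theta> * w1 * (factor x1 y1 * (1 - y1)) + (1 - \<theta>) * w2 * (factor x2 y2 * (1 - y2))"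
  define q where "q = \<theta> * w1 * (factor x1 y1 * y1) + (1 - \<theta>) * w2 * (factor x2 y2 * y2)"
  have nn: "0 \<le> \<theta> * w1" "0 \<le> (1 - \<theta>) * w2" using \<theta> w by auto
  have "0 \<le> b" "0 \<le> q"
    unfolding b_def q_def using nn y factor_bounds(3)[OF x(2) y(1)] factor_bounds(3)[OF x(3) y(2)]
    by (auto intro!: add_nonneg_nonneg mult_nonneg_nonneg)
  \<comment> \<open>\<open>c\<close> stands for either price; \<open>0 \<le> c\<close> lets surplus
    stock of the first position count as budget.\<close>
  have line: "b \<le> 1 - x0 - c * (q - x0)" if c: "0 \<le> c"
    and 1: "factor x1 y1 * (1 - y1) \<le> 1 - x1 - c * (factor x1 y1 * y1 - x1)"
    and 2: "factor x2 y2 * (1 - y2) \<le> 1 - x2 - c * (factor x2 y2 * y2 - x2)" for c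
  proof -
    have "b \<le> \<theta> * w1 * (1 - x1 - c * (factor x1 y1 * y1 - x1))
        + (1 - \<theta>) * w2 * (1 - x2 - c * (factor x2 y2 * y2 - x2))"
      unfolding b_def by (intro add_mono mult_left_mono 1 2 nn)
    also have "\<dots> = (\<theta> * (w1 * (1 - x1)) + (1 - \<theta>) * (w2 * (1 - x2)))
       + c * (\<theta> * (w1 * x1) + (1 - \<theta>) * (w2 * x2)) - c * q"
      unfolding q_def by (simp add: algebra_simps)
    also have "\<dots> \<le> (1 - x0) + c * x0 - c * q"
      using f c by (intro diff_right_mono add_mono mult_left_mono) (auto simp: feasible_def)
    finally show ?thesis by (simp add: algebra_simps)
  qed
  obtain y0 where y0: "y0 \<in> {0..1}" "b \<le> factor x0 y0 * (1 - y0)" "factor x0 y0 * y0 = q"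
  proof (rule budget_factor[OF x(1) \<open>0 \<le> b\<close> \<open>0 \<le> q\<close>])
    show "b \<le> 1 - x0 - (1 + eb) * (q - x0)" 
      by (rule line) (use eb factor_budget(1) x y in auto)
    show "b \<le> 1 - x0 - (1 - es) * (q - x0)" 
      by (rule line) (use es factor_budget(2) x y in auto)
  qed
  show ?thesis
  proof (rule that[OF y0(1)])
    have k: "0 < factor x0 y0" by (rule factor_bounds(3)[OF x(1) y0(1)])
    have "b / factor x0 y0 \<le> 1 - y0" "q / factor x0 y0 = y0"
      using k y0(2,3) by (auto simp: divide_simps mult.commute)
    then show "feasible \<theta> y0 (w1 * factor x1 y1 / factor x0 y0) y1 (w2 * factor x2 y2 / factor x0 y0) y2"
      unfolding feasible_def b_def q_def by (simp add: add_divide_distrib mult.assoc)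
  qed
qed

section \<open>The concavity defect and its minimum principle\<close>

text \<open>Zero weights are needed for compactness if \<open>a > 0\<close>, but must be excluded if \<open>a < 0\<close>, where
  \<open>0 powr a = 0\<close> is a junk value.\<close>

definition weight :: "real \<Rightarrow> bool" where
  "weight w \<longleftrightarrow> 0 \<le> w \<and> (a < 0 \<longrightarrow> 0 < w)"

definition defect :: "real \<Rightarrow> real \<Rightarrow> real \<Rightarrow> real \<Rightarrow> real \<Rightarrow> real \<Rightarrow> real \<Rightarrow> real" where
  "defect \<theta> t x0 w1 x1 w2 x2 =
     1 * u t x0 + (- (\<theta> * w1 powr a)) * u t x1 + (- ((1 - \<theta>) * w2 powr a)) * u t x2"

text \<open>Homogeneity of degree \<open>a\<close>: the factor \<open>k0 powr a\<close> undoes the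
  renormalization to unit wealth, be it after the flow or after a trade.\<close>

lemma defect_scale:
  assumes "0 < k0" "0 < k1" "0 < k2" "0 \<le> w1" "0 \<le> w2"
  shows "k0 powr a * defect \<theta> t x0 (w1 * k1 / k0) x1 (w2 * k2 / k0) x2 =
     1 * (k0 powr a * u t x0) + (- (\<theta> * w1 powr a)) * (k1 powr a * u t x1)
       + (- ((1 - \<theta>) * w2 powr a)) * (k2 powr a * u t x2)"
proof -
  have scale: "k0 powr a * (w * k / k0) powr a = w powr a * k powr a" if "0 \<le> w" "0 < k" for w k
    using that assms(1) by (simp add: powr_mult powr_divide)
  have "k0 powr a * defect \<theta> t x0 (w1 * k1 / k0) x1 (w2 * k2 / k0) x2 =
     1 * (k0 powr a * u t x0) + (- (\<theta> * (k0 powr a * (w1 * k1 / k0) powr a))) * u t x1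
       + (- ((1 - \<theta>) * (k0 powr a * (w2 * k2 / k0) powr a))) * u t x2"
    unfolding defect_def by (simp only: distrib_left mult_minus_left mult_minus_right mult.assoc mult.left_commute mult_1)
  also have "\<dots> = 1 * (k0 powr a * u t x0) + (- (\<theta> * w1 powr a)) * (k1 powr a * u t x1)
       + (- ((1 - \<theta>) * w2 powr a)) * (k2 powr a * u t x2)"
    unfolding scale[OF assms(4,2)] scale[OF assms(5,3)] by (simp add: mult.assoc)
  finally show ?thesis .
qed

text \<open>Terminal utility depends on total wealth alone. Feasibility gives
  \<open>\<theta> * w1 + (1 - \<theta>) * w2 \<le> 1\<close>, and the tangent at 1 does the
  rest.\<close>

lemma defect_terminal:
  assumes \<theta>: "0 < \<theta>" "\<theta> < 1" and x: "x0 \<in> {0..1}" "x1 \<in> {0..1}" "x2 \<in> {0..1}"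
    and w: "weight w1" "weight w2" and f: "feasible \<theta> x0 w1 x1 w2 x2"
  shows "0 \<le> defect \<theta> T x0 w1 x1 w2 x2"
proof -
  have tangent: "w powr a / a \<le> 1 / a + (w - 1)" if "weight w" for w
    using that a by (intro powr_tangent) (auto simp: weight_def)
  have "\<theta> * (w1 powr a / a) + (1 - \<theta>) * (w2 powr a / a)
      \<le> \<theta> * (1 / a + (w1 - 1)) + (1 - \<theta>) * (1 / a + (w2 - 1))"
    using \<theta> tangent[OF w(1)] tangent[OF w(2)] by (intro add_mono mult_left_mono) auto
  also have "\<dots> = 1 / a + (\<theta> * w1 + (1 - \<theta>) * w2 - 1)"
    by (simp add: algebra_simps diff_divide_distrib)
  also have "\<theta> * w1 + (1 - \<theta>) * w2 \<le> 1"
    using f by (simp add: feasible_def algebra_simps)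
  finally show ?thesis
    by (simp add: defect_def terminal_u[OF x(1)] terminal_u[OF x(2)] terminal_u[OF x(3)])
qed

lemma feasible_bounded:
  assumes \<theta>: "0 < \<theta>" "\<theta> < 1" and w: "0 \<le> w1" "0 \<le> w2" and f: "feasible \<theta> x0 w1 x1 w2 x2"
  shows "w1 \<le> 1 / \<theta>" "w2 \<le> 1 / (1 - \<theta>)"
proof -
  have "\<theta> * w1 + (1 - \<theta>) * w2 \<le> 1"
    using f by (simp add: feasible_def algebra_simps)
  moreover have "0 \<le> \<theta> * w1" "0 \<le> (1 - \<theta>) * w2" using \<theta> w by auto
  ultimately have "\<theta> * w1 \<le> 1" "(1 - \<theta>) * w2 \<le> 1" by auto
  then show "w1 \<le> 1 / \<theta>" "w2 \<le> 1 / (1 - \<theta>)" using \<theta> by (auto simp: field_simps)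
qed

text \<open>For \<open>a < 0\<close> the defect blows up as a weight tends to \<open>0\<close>, because \<open>u\<close> is negative;
  this makes up for the missing compactness of the set of positive weights.\<close>

lemma negative_defect_weights:
  assumes \<theta>: "0 < \<theta>" "\<theta> < 1"
  obtains \<eta> where "0 \<le> \<eta>" "a < 0 \<Longrightarrow> 0 < \<eta>"
    "\<And>t x0 w1 x1 w2 x2. \<lbrakk>t \<in> {0..T}; x0 \<in> {0..1}; x1 \<in> {0..1}; x2 \<in> {0..1}; weight w1; weight w2;
        defect \<theta> t x0 w1 x1 w2 x2 < 0\<rbrakk> \<Longrightarrow> \<eta> \<le> w1 \<and> \<eta> \<le> w2"
proof (cases "a < 0")
  case False
  show ?thesis by (rule that[of 0]) (use False in \<open>auto simp: weight_def\<close>)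
next
  case True
  have cont: "continuous_on ({0..T} \<times> {0..1}) (\<lambda>p. u (fst p) (snd p))"
    by (intro continuous_intros continuous_u_comp) auto
  have K: "compact ({0..T} \<times> {0..1::real})" "{0..T} \<times> {0..1::real} \<noteq> {}"
    using T by (auto intro: compact_Times)
  obtain p where p: "p \<in> {0..T} \<times> {0..1}" "\<forall>q\<in>{0..T} \<times> {0..1}. u (fst q) (snd q) \<le> u (fst p) (snd p)"
    using continuous_attains_sup[OF K cont] by blast
  obtain p' where p': "p' \<in> {0..T} \<times> {0..1}" "\<forall>q\<in>{0..T} \<times> {0..1}. u (fst p') (snd p') \<le> u (fst q) (snd q)"
    using continuous_attains_inf[OF K cont] by blast
  define c where "c = - u (fst p) (snd p)"
  define L where "L = - u (fst p') (snd p')"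
  have c: "0 < c" using u_negative[OF True, of "fst p" "snd p"] p(1) by (auto simp: c_def)
  have L: "0 < L" using u_negative[OF True, of "fst p'" "snd p'"] p'(1) by (auto simp: L_def)
  have uc: "u t x \<le> - c" and uL: "- L \<le> u t x" if "t \<in> {0..T}" "x \<in> {0..1}" for t x
    using p(2)[rule_format, of "(t, x)"] p'(2)[rule_format, of "(t, x)"] that by (auto simp: c_def L_def)
  define m where "m = min \<theta> (1 - \<theta>)"
  have m: "0 < m" "m \<le> \<theta>" "m \<le> 1 - \<theta>" using \<theta> by (auto simp: m_def)
  \<comment> \<open>Chosen so that \<open>m * \<eta> powr a * c = L\<close>: a weight below
    \<open>\<eta>\<close> makes one term exceed \<open>L\<close>, which
    \<open>u t x0 \<ge> - L\<close> cannot offset.\<close>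
  define \<eta> where "\<eta> = (L / (m * c)) powr (1 / a)"
  have \<eta>: "0 < \<eta>" "\<eta> powr a = L / (m * c)"
    using L c m True by (auto simp: \<eta>_def powr_powr)
  have large: "L < \<tau> * w powr a * - u t x"
    if w: "weight w" "w < \<eta>" and \<tau>: "m \<le> \<tau>" and "t \<in> {0..T}" "x \<in> {0..1}" for w \<tau> t x
  proof -
    have "L / (m * c) < w powr a"
      using w True powr_less_mono2_neg[of a w \<eta>] by (simp add: weight_def \<eta>(2))
    then have "L < m * w powr a * c" using m c by (simp add: field_simps)
    also have "\<dots> \<le> \<tau> * w powr a * - u t x"
      using \<tau> uc[OF that(4,5)] m c by (intro mult_mono) auto
    finally show ?thesis .
  qed
  have nonneg: "0 \<le> \<tau> * w powr a * - u t x" if "0 \<le> \<tau>" "t \<in> {0..T}" "x \<in> {0..1}" for \<tau> w t x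
    using uc[OF that(2,3)] c that(1) by (intro mult_nonneg_nonneg) auto
  show ?thesis
  proof (rule that[of \<eta>])
    fix t x0 w1 x1 w2 x2
    assume t: "t \<in> {0..T}" and x: "x0 \<in> {0..1}" "x1 \<in> {0..1}" "x2 \<in> {0..1}"
      and w: "weight w1" "weight w2" and D: "defect \<theta> t x0 w1 x1 w2 x2 < 0"
    have D': "u t x0 + \<theta> * w1 powr a * - u t x1 + (1 - \<theta>) * w2 powr a * - u t x2 < 0"
      using D by (simp add: defect_def)
    show "\<eta> \<le> w1 \<and> \<eta> \<le> w2"
    proof (rule ccontr)
      assume "\<not> (\<eta> \<le> w1 \<and> \<eta> \<le> w2)"
      then consider "w1 < \<eta>" | "w2 < \<eta>" by linarith
      then show False
      proof cases
        case 1
        show False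
          using large[OF w(1) 1 m(2) t x(2)] nonneg[of "1 - \<theta>" t x2 w2] \<theta> t x uL[OF t x(1)] D' by auto
      next
        case 2
        show False
          using large[OF w(2) 2 m(3) t x(3)] nonneg[of "\<theta>" t x1 w1] \<theta> t x uL[OF t x(1)] D' by auto
      qed
    qed
  qed (use \<eta> in auto)
qed

lemma continuous_defect:
  assumes "0 \<le> \<eta>" "a < 0 \<Longrightarrow> 0 < \<eta>"
  shows "continuous_on ({0..T} \<times> {0..1} \<times> {\<eta>..R1} \<times> {0..1} \<times> {\<eta>..R2} \<times> {0..1})
    (\<lambda>(t, x0, w1, x1, w2, x2). exp (K * t) * defect \<theta> t x0 w1 x1 w2 x2)"
proof -
  \<comment> \<open>\<open>powr\<close> with nonnegative base is continuous off base 0 or for a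
    positive exponent; \<open>\<eta>\<close> keeps the base off 0 when \<open>a < 0\<close>.\<close>
  have "w \<noteq> 0 \<or> 0 < a" if "\<eta> \<le> w" for w
    using assms a that by (cases "a < 0") auto
  then have pow: "continuous_on A (\<lambda>p. f p powr a)"
    if "continuous_on A f" "\<And>p. p \<in> A \<Longrightarrow> \<eta> \<le> f p" for A and f :: "'c::topological_space \<Rightarrow> real"
    using that assms(1) by (intro continuous_on_powr' continuous_on_const) force+
  then show ?thesis
    unfolding defect_def case_prod_beta
    by (intro pow continuous_on_add continuous_on_mult continuous_on_minus continuous_on_exp
        continuous_on_const continuous_u_comp continuous_on_fst continuous_on_snd continuous_on_id) auto
qed

lemma closed_feasible:
  "closed {(t::real, x0, w1, x1, w2, x2). feasible \<theta> x0 w1 x1 w2 x2}"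
  unfolding feasible_def case_prod_beta
  by (intro closed_Collect_conj closed_Collect_le continuous_intros)

text \<open>By contradiction: a negative minimum of \<open>exp (K * t) * defect\<close> over a
  compact feasible set is tested against later times, the flow, and trades, which together violate
  the HJB equation.\<close>

lemma defect_nonneg:
  assumes \<theta>: "0 < \<theta>" "\<theta> < 1" and t: "t \<in> {0..T}"
    and x: "x0 \<in> {0..1}" "x1 \<in> {0..1}" "x2 \<in> {0..1}"
    and w: "weight w1" "weight w2" and f: "feasible \<theta> x0 w1 x1 w2 x2"
  shows "0 \<le> defect \<theta> t x0 w1 x1 w2 x2"
proof (rule ccontr)
  assume neg: "\<not> 0 \<le> defect \<theta> t x0 w1 x1 w2 x2"
  obtain B where B: "0 \<le> B" "\<And>x. x \<in> {0..1} \<Longrightarrow> \<bar>Q \<mu> \<sigma> \<gamma> x\<bar> \<le> B" by (rule Q_bound) blast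
  obtain \<eta> where \<eta>: "0 \<le> \<eta>" "a < 0 \<Longrightarrow> 0 < \<eta>"
    and large: "\<And>t x0 w1 x1 w2 x2. \<lbrakk>t \<in> {0..T}; x0 \<in> {0..1}; x1 \<in> {0..1}; x2 \<in> {0..1}; weight w1; weight w2;
        defect \<theta> t x0 w1 x1 w2 x2 < 0\<rbrakk> \<Longrightarrow> \<eta> \<le> w1 \<and> \<eta> \<le> w2"
    by (rule negative_defect_weights[OF \<theta>]) blast
  \<comment> \<open>\<open>K\<close> exceeds \<open>lam * C - lam + Q\<close>, which makes the
    bracket multiplying the negative \<open>W\<close> at the end negative.\<close>
  define K where "K = lam * C + B + 1"
  define G where "G = (\<lambda>(t, x0, w1, x1, w2, x2). exp (K * t) * defect \<theta> t x0 w1 x1 w2 x2)"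
  define Z where "Z = {0..T} \<times> {0..1::real} \<times> {\<eta>..1 / \<theta>} \<times> {0..1::real} \<times> {\<eta>..1 / (1 - \<theta>)} \<times> {0..1::real}"
  define F where "F = Z \<inter> {(t::real, x0, w1, x1, w2, x2). feasible \<theta> x0 w1 x1 w2 x2}"
  have memF: "(t, x0, w1, x1, w2, x2) \<in> F"
    if "t \<in> {0..T}" "x0 \<in> {0..1}" "x1 \<in> {0..1}" "x2 \<in> {0..1}" "weight w1" "weight w2"
       "feasible \<theta> x0 w1 x1 w2 x2" "defect \<theta> t x0 w1 x1 w2 x2 < 0" for t x0 w1 x1 w2 x2
    using large[OF that(1-6,8)] feasible_bounded[OF \<theta> _ _ that(7)] that
    by (auto simp: F_def Z_def weight_def)
  have start: "(t, x0, w1, x1, w2, x2) \<in> F" using memF[OF t x w f] neg by auto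
  have "compact Z" unfolding Z_def by (intro compact_Times compact_Icc)
  then have "compact F" unfolding F_def by (intro compact_Int_closed closed_feasible)
  moreover have "continuous_on F G"
    using continuous_defect[OF \<eta>] unfolding G_def F_def Z_def
    by (rule continuous_on_subset) auto
  moreover have "F \<noteq> {}" using start by auto
  ultimately obtain p where p: "p \<in> F" "\<forall>q\<in>F. G p \<le> G q"
    using continuous_attains_inf by metis
  obtain t' z0 v1 z1 v2 z2 where p_eq: "p = (t', z0, v1, z1, v2, z2)" by (cases p) auto
  define W where "W = defect \<theta> t' z0 v1 z1 v2 z2"
  have t': "t' \<in> {0..T}" and z: "z0 \<in> {0..1}" "z1 \<in> {0..1}" "z2 \<in> {0..1}"
    and v: "weight v1" "weight v2" and f': "feasible \<theta> z0 v1 z1 v2 z2"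
    using p(1) \<eta> by (auto simp: p_eq F_def Z_def weight_def)
  have v0: "0 \<le> v1" "0 \<le> v2" using v by (auto simp: weight_def)
  have "G p \<le> G (t, x0, w1, x1, w2, x2)" using p(2) start by blast
  also have "\<dots> < 0" using neg by (simp add: G_def mult_pos_neg)
  finally have "G p < 0" .
  then have W: "W < 0" by (simp add: p_eq G_def W_def mult_less_0_iff)
  \<comment> \<open>Minimality extends from \<open>F\<close> to all feasible points, since those
    outside \<open>F\<close> have nonnegative defect.\<close>
  have min: "exp (K * t') * W \<le> exp (K * s) * defect \<theta> s x0 w1 x1 w2 x2"
    if "s \<in> {0..T}" "x0 \<in> {0..1}" "x1 \<in> {0..1}" "x2 \<in> {0..1}" "weight w1" "weight w2"
       "feasible \<theta> x0 w1 x1 w2 x2" for s x0 w1 x1 w2 x2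
  proof (cases "defect \<theta> s x0 w1 x1 w2 x2 < 0")
    case True
    from p(2) memF[OF that True] show ?thesis by (force simp: G_def p_eq W_def)
  next
    case False
    have "exp (K * t') * W \<le> 0" using W by (simp add: mult_le_0_iff)
    also have "0 \<le> exp (K * s) * defect \<theta> s x0 w1 x1 w2 x2" using False by simp
    finally show ?thesis .
  qed
  have min': "W \<le> defect \<theta> t' x0 w1 x1 w2 x2"
    if "x0 \<in> {0..1}" "x1 \<in> {0..1}" "x2 \<in> {0..1}" "weight w1" "weight w2"
       "feasible \<theta> x0 w1 x1 w2 x2" for x0 w1 x1 w2 x2
    using min[OF t' that] by simp
  have "t' \<noteq> T" using defect_terminal[OF \<theta> z v f'] W by (auto simp: W_def)
  with t' have tT: "t' < T" by auto
  define c1 where "c1 = - (\<theta> * v1 powr a)"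
  define c2 where "c2 = - ((1 - \<theta>) * v2 powr a)"
  have weight_scale: "weight (w * k1 / k0)" if "weight w" "0 < k1" "0 < k0" for w k0 k1
    using that by (auto simp: weight_def)
  \<comment> \<open>Moving all three positions along the flow keeps them feasible, so minimality,
    scaled back by homogeneity, is the hypothesis of \<open>generator_minimum\<close>.\<close>
  have ge: "W * flow_mass z0 s powr a \<le>
       1 * (flow_mass z0 s powr a * u t' (flow_frac z0 s))
       + c1 * (flow_mass z1 s powr a * u t' (flow_frac z1 s))
       + c2 * (flow_mass z2 s powr a * u t' (flow_frac z2 s))" for s
  proof -
    note pos = flow_mass_pos[OF z(1), of s] flow_mass_pos[OF z(2), of s] flow_mass_pos[OF z(3), of s]
    have "W \<le> defect \<theta> t' (flow_frac z0 s) (v1 * flow_mass z1 s / flow_mass z0 s) (flow_frac z1 s)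
       (v2 * flow_mass z2 s / flow_mass z0 s) (flow_frac z2 s)"
      by (intro min' flow_frac_mem z weight_scale v pos feasible_flow f')
    then have "flow_mass z0 s powr a * W \<le> flow_mass z0 s powr a *
       defect \<theta> t' (flow_frac z0 s) (v1 * flow_mass z1 s / flow_mass z0 s) (flow_frac z1 s)
       (v2 * flow_mass z2 s / flow_mass z0 s) (flow_frac z2 s)"
      by (intro mult_left_mono) auto
    then show ?thesis
      unfolding defect_scale[OF pos v0] c1_def c2_def by (simp add: mult.commute)
  qed
  have W_eq: "W = 1 * u t' z0 + c1 * u t' z1 + c2 * u t' z2"
    by (simp add: W_def defect_def c1_def c2_def)
  obtain d where d: "((\<lambda>s. 1 * u s z0 + c1 * u s z1 + c2 * u s z2) has_real_derivative d) (at t' within {0..T})"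
    "d + lam * (1 * M t' z0 + c1 * M t' z1 + c2 * M t' z2 - W) + Q \<mu> \<sigma> \<gamma> z0 * W \<le> 0"
    by (rule generator_minimum[OF t' z W_eq ge])
  have dd: "((\<lambda>s. defect \<theta> s z0 v1 z1 v2 z2) has_real_derivative d) (at t' within {0..T})"
    using d(1) by (simp add: defect_def c1_def c2_def)
  have "((\<lambda>s. exp (K * s) * defect \<theta> s z0 v1 z1 v2 z2) has_real_derivative
        exp (K * t') * (K * W + d)) (at t' within {0..T})"
    by (rule derivative_eq_intros dd refl)+ (simp add: W_def algebra_simps)
  then have "0 \<le> exp (K * t') * (K * W + d)"
    by (rule right_minimum_derivative)
      (use t' tT min[OF _ z v f'] in \<open>auto simp: W_def\<close>)
  then have dK: "- (K * W) \<le> d" by (simp add: zero_le_mult_iff)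
  \<comment> \<open>The optimal trades \<open>y1\<close>, \<open>y2\<close> of the two subtracted
    positions are answered by a feasible, possibly suboptimal trade \<open>y0\<close>, which still
    bounds \<open>M t' z0\<close> from below.\<close>
  obtain y1 where y1: "y1 \<in> {0..1}" "M t' z1 = factor z1 y1 powr a * u t' y1"
    by (rule M_attained[OF t' z(2)])
  obtain y2 where y2: "y2 \<in> {0..1}" "M t' z2 = factor z2 y2 powr a * u t' y2"
    by (rule M_attained[OF t' z(3)])
  have \<theta>': "0 \<le> \<theta>" "\<theta> \<le> 1" using \<theta> by auto
  obtain y0 where y0: "y0 \<in> {0..1}" and fy: "feasible \<theta> y0 (v1 * factor z1 y1 / factor z0 y0) y1
     (v2 * factor z2 y2 / factor z0 y0) y2"
    by (rule feasible_trade[OF z f' y1(1) y2(1) \<theta>' v0])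
  note pos = factor_bounds(3)[OF z(1) y0] factor_bounds(3)[OF z(2) y1(1)] factor_bounds(3)[OF z(3) y2(1)]
  have "C * W \<le> factor z0 y0 powr a * W"
    using factor_powr_le[OF z(1) y0] W by (intro mult_right_mono_neg) auto
  also have "\<dots> \<le> factor z0 y0 powr a * defect \<theta> t' y0 (v1 * factor z1 y1 / factor z0 y0) y1
     (v2 * factor z2 y2 / factor z0 y0) y2"
    by (intro mult_left_mono min' y0 y1 y2 weight_scale v pos fy) auto
  also have "\<dots> = factor z0 y0 powr a * u t' y0 + c1 * M t' z1 + c2 * M t' z2"
    unfolding defect_scale[OF pos v0] y1 y2 c1_def c2_def by simp
  also have "\<dots> \<le> M t' z0 + c1 * M t' z1 + c2 * M t' z2"
    using M_upper[OF t' z(1) y0] by simp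
  finally have "lam * (C * W) \<le> lam * (M t' z0 + c1 * M t' z1 + c2 * M t' z2)"
    using lam by simp
  moreover have "0 < W * (- K + lam * C - lam + Q \<mu> \<sigma> \<gamma> z0)"
    using W B(2)[OF z(1)] lam by (intro mult_neg_neg) (auto simp: K_def)
  ultimately show False using dK d(2) by (simp add: algebra_simps)
qed

section \<open>Strict unimodality and the optimal trade\<close>

text \<open>On the line \<open>b + (1 + e) * s = 1\<close> fraction \<open>z\<close> has wealth
  \<open>1 / (1 + e * z)\<close>, so the quotient is \<open>U\<close> on that line. Concavity
  between \<open>m\<close> and \<open>y\<close> and the strict maximum at \<open>m\<close> put the
  value at \<open>x\<close> above that at \<open>y\<close>.\<close>

lemma strictly_unimodal:
  assumes e: "-1 < e" and t: "t \<in> {0..T}"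
    and xmy: "x \<in> {0..1}" "m \<in> {0..1}" "y \<in> {0..1}"
    and max: "\<And>z. z \<in> {0..1} \<Longrightarrow> z \<noteq> m \<Longrightarrow> u t z / (1 + e * z) powr a < u t m / (1 + e * m) powr a"
    and between: "m \<le> x \<and> x < y \<or> y < x \<and> x \<le> m"
  shows "u t y / (1 + e * y) powr a < u t x / (1 + e * x) powr a"
proof (cases "x = m")
  case True
  with max[OF xmy(3)] between show ?thesis by auto
next
  case False
  have pos: "0 < 1 + e * z" if "z \<in> {0..1}" for z
  proof -
    have "0 < (1 - z) * 1 + z * (1 + e)"
      using that e by (cases "z = 0") (auto intro!: add_nonneg_pos)
    then show ?thesis by (simp add: algebra_simps)
  qed
  define \<rho> where "\<rho> = (y - x) / (y - m)"
  have \<rho>: "0 < \<rho>" "\<rho> < 1"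
    using between False by (auto simp: \<rho>_def divide_simps)
  have conv: "\<rho> * m + (1 - \<rho>) * y = x"
  proof -
    have "\<rho> * (y - m) = y - x" using between by (auto simp: \<rho>_def)
    then show ?thesis by (simp add: algebra_simps)
  qed
  \<comment> \<open>With unit wealth at \<open>x\<close>, this choice yields
    \<open>\<theta> * w1 = \<rho>\<close> and \<open>(1 - \<theta>) * w2 = 1 - \<rho>\<close>, so
    the combination is exactly \<open>(1 - x, x)\<close>.\<close>
  define \<theta> where "\<theta> = \<rho> * (1 + e * m) / (1 + e * x)"
  have "\<rho> * (1 + e * m) + (1 - \<rho>) * (1 + e * y) = 1 + e * (\<rho> * m + (1 - \<rho>) * y)"
    by (simp add: algebra_simps)
  then have \<theta>': "1 - \<theta> = (1 - \<rho>) * (1 + e * y) / (1 + e * x)"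
    using pos[OF xmy(1)] unfolding conv by (simp add: \<theta>_def field_simps)
  have "0 < \<theta>" "0 < 1 - \<theta>"
    unfolding \<theta>' using \<rho> pos xmy by (simp_all add: \<theta>_def)
  then have \<theta>: "0 < \<theta>" "\<theta> < 1" by auto
  define w1 where "w1 = (1 + e * x) / (1 + e * m)"
  define w2 where "w2 = (1 + e * x) / (1 + e * y)"
  have w: "weight w1" "weight w2" using pos[OF xmy(1)] pos[OF xmy(2)] pos[OF xmy(3)]
    by (simp_all add: weight_def w1_def w2_def)
  have tw: "\<theta> * w1 = \<rho>" "(1 - \<theta>) * w2 = 1 - \<rho>"
    unfolding \<theta>' using pos[OF xmy(1)] pos[OF xmy(2)] pos[OF xmy(3)]
    by (simp_all add: \<theta>_def w1_def w2_def)
  have "feasible \<theta> x w1 m w2 y"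
    unfolding feasible_def mult.assoc[symmetric] tw using conv by (simp add: algebra_simps)
  then have "0 \<le> defect \<theta> t x w1 m w2 y"
    by (rule defect_nonneg[OF \<theta> t xmy w])
  then have "(\<theta> * (w1 powr a * u t m) + (1 - \<theta>) * (w2 powr a * u t y)) / (1 + e * x) powr a
      \<le> u t x / (1 + e * x) powr a"
    by (intro divide_right_mono) (auto simp: defect_def)
  moreover have "(\<theta> * (w1 powr a * u t m) + (1 - \<theta>) * (w2 powr a * u t y)) / (1 + e * x) powr a
      = \<theta> * (u t m / (1 + e * m) powr a) + (1 - \<theta>) * (u t y / (1 + e * y) powr a)"
  proof -
    have "w1 powr a = (1 + e * x) powr a / (1 + e * m) powr a"
      "w2 powr a = (1 + e * x) powr a / (1 + e * y) powr a"
      unfolding w1_def w2_def using pos xmy by (auto intro!: powr_divide less_imp_le)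
    moreover have "(1 + e * x) powr a \<noteq> 0" using pos[OF xmy(1)] by simp
    ultimately show ?thesis by (simp add: add_divide_distrib)
  qed
  moreover have "\<theta> * (u t y / (1 + e * y) powr a) < \<theta> * (u t m / (1 + e * m) powr a)"
    using max[OF xmy(3)] between \<theta> by (intro mult_strict_left_mono) auto
  ultimately have "\<theta> * (u t m / (1 + e * m) powr a) + (1 - \<theta>) * (u t y / (1 + e * y) powr a)
      \<le> u t x / (1 + e * x) powr a"
    and "\<theta> * (u t y / (1 + e * y) powr a) < \<theta> * (u t m / (1 + e * m) powr a)" by simp_all
  then show ?thesis unfolding left_diff_distrib by linarith
qed

text \<open>For \<open>y \<ge> x\<close> the objective is a positive multiple of the purchase
  quotient, for \<open>y \<le> x\<close> of the sale quotient. Both cover \<open>y = x\<close>, so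
  comparisons across \<open>x\<close> pass through not trading.\<close>

lemma argmax_trade_objective:
  assumes t: "t \<in> {0..T}" and m: "l \<in> {0..1}" "h \<in> {0..1}" "l \<le> h" and x: "x \<in> {0..1}"
    and low: "\<And>z. z \<in> {0..1} \<Longrightarrow> z \<noteq> l \<Longrightarrow> u t z / (1 + eb * z) powr a < u t l / (1 + eb * l) powr a"
    and high: "\<And>z. z \<in> {0..1} \<Longrightarrow> z \<noteq> h \<Longrightarrow> u t z / (1 - es * z) powr a < u t h / (1 - es * h) powr a"
    and k: "k = (if x < l then l else if x \<le> h then x else h)"
    and y: "y \<in> {0..1}" "y \<noteq> k"
  shows "trade_objective \<gamma> eb es v t x y < trade_objective \<gamma> eb es v t x k"
proof -
  let ?f = "trade_objective \<gamma> eb es v t x"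
  have buy: "?f z = (1 + eb * x) powr a * (u t z / (1 + eb * z) powr a)" if "z \<in> {0..1}" "x \<le> z" for z
    using that cost_pos[OF x] cost_pos[OF that(1)] by (simp add: objective_eq factor_def powr_divide)
  have sell: "?f z = (1 - es * x) powr a * (u t z / (1 - es * z) powr a)" if "z \<in> {0..1}" "z \<le> x" for z
    using that cost_pos[OF x] cost_pos[OF that(1)] by (cases "z = x") (auto simp: objective_eq factor_def powr_divide)
  have buy_less: "?f z < ?f z'" if "z \<in> {0..1}" "z' \<in> {0..1}" "x \<le> z" "x \<le> z'"
     "u t z / (1 + eb * z) powr a < u t z' / (1 + eb * z') powr a" for z z'
    unfolding buy[OF that(1,3)] buy[OF that(2,4)]
    using that(5) cost_pos[OF x] by (intro mult_strict_left_mono) auto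
  have sell_less: "?f z < ?f z'" if "z \<in> {0..1}" "z' \<in> {0..1}" "z \<le> x" "z' \<le> x"
     "u t z / (1 - es * z) powr a < u t z' / (1 - es * z') powr a" for z z'
    unfolding sell[OF that(1,3)] sell[OF that(2,4)]
    using that(5) cost_pos[OF x] by (intro mult_strict_left_mono) auto
  have up: "?f z < ?f x" if "z \<in> {0..1}" "x < z" "l \<le> x" for z
    using that x strictly_unimodal[of eb t x l z] eb t m low by (intro buy_less) auto
  have down: "?f z < ?f x" if "z \<in> {0..1}" "z < x" "x \<le> h" for z
    using that x strictly_unimodal[of "- es" t x h z] es t m high by (intro sell_less) auto
  have to_low: "?f z < ?f l" if "z \<in> {0..1}" "x \<le> z" "x < l" "z \<noteq> l" for z
    using that m low by (intro buy_less) auto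
  have to_high: "?f z < ?f h" if "z \<in> {0..1}" "z \<le> x" "h < x" "z \<noteq> h" for z
    using that m high by (intro sell_less) auto
  consider "x < l" | "l \<le> x" "x \<le> h" | "h < x" by linarith
  then show ?thesis
  proof cases
    case 1
    then have kl: "k = l" by (simp add: k)
    show ?thesis
    proof (cases "x \<le> y")
      case True
      then show ?thesis using to_low[of y] y 1 by (simp add: kl)
    next
      case False
      \<comment> \<open>Since \<open>x < l \<le> h\<close>, selling is worse than not trading, which
        is worse than buying up to \<open>l\<close>.\<close>
      then have "?f y < ?f x" using down[of y] y 1 m by simp
      also have "\<dots> < ?f l" using to_low[of x] x 1 by simp
      finally show ?thesis by (simp add: kl)
    qed
  next
    case 2
    then have "k = x" by (simp add: k)
    then show ?thesis using up[of y] down[of y] y 2 by (cases "x < y") auto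
  next
    case 3
    then have kh: "k = h" using m by (simp add: k)
    show ?thesis
    proof (cases "y \<le> x")
      case True
      then show ?thesis using to_high[of y] y 3 by (simp add: kh)
    next
      case False
      then have "?f y < ?f x" using up[of y] y 3 m by simp
      also have "\<dots> < ?f h" using to_high[of x] x 3 by simp
      finally show ?thesis by (simp add: kh)
    qed
  qed
qed

end

section \<open>From unique maximizers to the stated argmax\<close>

text \<open>Turns uniqueness into strictness: a point outside the argmax is beaten by some
  \<open>z\<close>, and \<open>z\<close> does not beat \<open>m\<close>.\<close>

lemma argmax_on_eq_singleton_iff:
  "argmax_on f A = {m} \<longleftrightarrow> m \<in> A \<and> (\<forall>y\<in>A. y \<noteq> m \<longrightarrow> f y < f m)"
proof
  assume L: "argmax_on f A = {m}"
  then have m: "m \<in> A" "\<And>z. z \<in> A \<Longrightarrow> f z \<le> f m"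
    by (auto simp: argmax_on_def is_arg_max_def set_eq_iff not_less)
  have "f y < f m" if y: "y \<in> A" "y \<noteq> m" for y
  proof -
    have "y \<notin> argmax_on f A" using L y by simp
    then obtain z where "z \<in> A" "f y < f z" using y by (auto simp: argmax_on_def is_arg_max_def)
    with m(2)[of z] show ?thesis by simp
  qed
  with m show "m \<in> A \<and> (\<forall>y\<in>A. y \<noteq> m \<longrightarrow> f y < f m)" by blast
next
  assume "m \<in> A \<and> (\<forall>y\<in>A. y \<noteq> m \<longrightarrow> f y < f m)"
  then show "argmax_on f A = {m}"
    by (auto simp: argmax_on_def is_arg_max_def)
qed

theorem theorem4p2:
  fixes \<mu> \<sigma> T lam \<gamma> eb es :: real
    and v :: "real \<Rightarrow> real \<Rightarrow> real"
    and ylow yhigh :: "real \<Rightarrow> real"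
    and t :: real
  assumes "\<sigma> > 0" and "T > 0" and "lam > 0"
    and "\<gamma> > 0" and "\<gamma> \<noteq> 1"
    and "eb > 0" and "0 < es" and "es < 1"
    and "solves_HJB \<mu> \<sigma> T lam \<gamma> eb es v"
    and "\<And>s. s \<in> {0..<T} \<Longrightarrow> 0 \<le> ylow s \<and> ylow s \<le> yhigh s \<and> yhigh s \<le> 1"
    and "\<And>s. s \<in> {0..<T} \<Longrightarrow>
           argmax_on (\<lambda>y. v s y / ((1 - \<gamma>) * (1 + eb * y) powr (1 - \<gamma>))) {0..1} = {ylow s}"
    and "\<And>s. s \<in> {0..<T} \<Longrightarrow>
           argmax_on (\<lambda>y. v s y / ((1 - \<gamma>) * (1 - es * y) powr (1 - \<gamma>))) {0..1} = {yhigh s}"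
    and "t \<in> {0..<T}"
  shows "\<forall>x\<in>{0..1}.
           argmax_on (trade_objective \<gamma> eb es v t x) {0..1} =
             {if x < ylow t then ylow t else if x \<le> yhigh t then x else yhigh t}"
proof
  fix x :: real assume x: "x \<in> {0..1}"
  interpret hjb \<mu> \<sigma> T lam \<gamma> eb es v
    using assms(1-9) by unfold_locales
  have eq: "v t z / (a * c) = u t z / c" for z c
    by (simp add: u_def)
  have t: "t \<in> {0..T}" using assms(13) by auto
  have order: "ylow t \<le> yhigh t" using assms(10)[OF assms(13)] by simp
  note low = assms(11)[OF assms(13), unfolded argmax_on_eq_singleton_iff eq a_def[symmetric]]
  note high = assms(12)[OF assms(13), unfolded argmax_on_eq_singleton_iff eq a_def[symmetric]]
  show "argmax_on (trade_objective \<gamma> eb es v t x) {0..1} =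
     {if x < ylow t then ylow t else if x \<le> yhigh t then x else yhigh t}"
    unfolding argmax_on_eq_singleton_iff
  proof (intro conjI ballI impI)
    show "(if x < ylow t then ylow t else if x \<le> yhigh t then x else yhigh t) \<in> {0..1}"
      using low high x by auto
  qed (rule argmax_trade_objective[OF t _ _ order x _ _ refl]; use low high in blast)
qed

end
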